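(* Let $p\in[1,+\infty)$, $p\neq d_y/2$. Suppose: (i) there is a constant $a>p$ such that $\mathbb{E}[\exp(\|\varepsilon\|^a)]<+\infty$; (ii) for a.e. $x\in\mathcal{X}$ and any risk level $\alpha\in(0,1)$ there exists a constant $\kappa_{p,n}(\alpha,x)>0$ such that $$\mathbb{P}\{\|f^*(x)-\hat f_n(x)\|^p>\kappa_{p,n}^p(\alpha,x)\}\le\alpha,\qquad \mathbb{P}\Big\{\tfrac1n\sum_{i=1}^n\|f^*(x^i)-\hat f_n(x^i)\|^p>\kappa_{p,n}^p(\alpha,x)\Big\}\le\alpha;$$ (iii) for any constant $\kappa>0$ there exist positive constants $K_{p,f}(\kappa,x)$, $\bar K_{p,f}(\kappa)$, $\beta_{p,f}(\kappa,x)$, $\bar\beta_{p,f}(\kappa)$ satisfying $$\mathbb P\{\|f^*(x)-\hat f_n(x)\|^p>\kappa^p\}\le K_{p,f}(\kappa,x)\exp(-n\beta_{p,f}(\kappa,x))\ \text{ for a.e. }x\in\mathcal X,$$ $$\mathbb P\Big\{\tfrac1n\sum_{i=1}^n\|f^*(x^i)-\hat f_n(x^i)\|^p>\kappa^p\Big\}\le\bar K_{p,f}(\kappa)\exp(-n\bar\beta_{p,f}(\kappa));$$ (iv) $c(\cdot,y)$ is lower semicontinuous on $\mathcal Z$ for each $y\in\mathcal Y$, $c(z,\cdot)$ is continuous on $\mathcal Y$ for each $z\in\mathcal Z$, and there is a constant $B_{c,p}\ge0$ with $|c(z,y)|\le B_{c,p}(1+\|y\|^p)$ for all $z\in\mathcal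 Z$, $y\in\mathcal Y$; (v) the samples $\{\varepsilon^i\}_{i=1}^n$ are i.i.d.; (vi) either (A) for each $z\in\mathcal Z$, $c(z,\cdot)$ is Lipschitz continuous on $\mathcal Y$ with Lipschitz constant $L_1(z)$; or (B) $p\ge2$ and, for each $z\in\mathcal Z$, $c(z,\cdot)$ is differentiable on $\mathcal Y$ with $\mathbb E[\|\nabla c(z,Y)\|^2]<+\infty$ and $\|\nabla c(z,\bar y)-\nabla c(z,y)\|\le L_2(z)\|\bar y-y\|$ for all $y,\bar y\in\mathcal Y$ (gradients in the second argument). Then, for a.e. $x\in\mathcal X$ and any $\eta>0$, there exist positive constants $\Gamma(\eta,x)$ and $\gamma(\eta,x)$ such that the solution $\hat z^{DRO}_n(x)$ of the Wasserstein ER-DRO problem with risk level $\alpha=\Gamma(\eta,x)\exp(-n\gamma(\eta,x))$, radius $\zeta_n(\alpha,x)$ as defined in the context (with the constants $\kappa_{p,n}$ of (ii)), and ambiguity set $\hat{\mathcal P}_n(x;\zeta_n(\alpha,x))$ satisfies $$\mathbb P\{\mathrm{dist}(\hat z^{DRO}_n(x),S^*(x))\ge\eta\}\le2\Gamma(\eta,x)\exp(-n\gamma(\eta,x)).$$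
   Context: Setup. $Y=f^*(X)+\varepsilon$, where $X$ is a random vector with support $\mathcal X\subseteq\mathbb R^{d_x}$ and distribution $P_X$, $Y$ is a random vector with nonempty convex support $\mathcal Y\subseteq\mathbb R^{d_y}$, $f^*(x):=\mathbb E[Y\mid X=x]$, and the zero-mean error $\varepsilon$ (distribution $P_\varepsilon$) is independent of $X$. $P_{Y\mid X=x}$ is the conditional distribution of $Y$ given $X=x$, i.e. the law of $f^*(x)+\varepsilon$. "A.e. $x$" is with respect to $P_X$. $\|\cdot\|$ is the Euclidean norm and $\mathrm{dist}(v,B):=\inf_{w\in B}\|v-w\|$. $\mathcal Z\subseteq\mathbb R^{d_z}$ is nonempty and compact, $c:\mathcal Z\times\mathcal Y\to\mathbb R$, $\mathbb E|c(z,f^*(x)+\varepsilon)|<\infty$ for each $z\in\mathcal Z$ and a.e. $x$, and $g(z;x):=\mathbb E[c(z,f^*(x)+\varepsilon)]$ is lower semicontinuous in $z$ on $\mathcal Z$ for a.e. $x$. The true problem is $v^*(x):=\min_{z\in\mathcal Z}g(z;x)$ with set of optimal solutions $S^*(x)$. All functions, sets and selections are assumed measurable. Data. $\mathcal D_n=\{(y^i,x^i)\}_{i=1}^n$ are joint observations of $(Y,X)$, $\varepsilon^i:=y^i-f^*(x^i)$; $\hat f_n$ is an estimate of $f^*$ built from $\mathcal D_n$ by a regression method, with residuals $\hat\varepsilon^i_n:=y^i-\hat f_n(x^i)$. Probabilities $\mathbb P$ refer to the data. With $\mathrm{proj}_{\mathcal Y}$ the orthogonal projection onto $\mathcal Y$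 and $\delta$ the Dirac measure, $$P^*_n(x):=\tfrac1n\sum_{i=1}^n\delta_{f^*(x)+\varepsilon^i},\qquad \hat P^{ER}_n(x):=\tfrac1n\sum_{i=1}^n\delta_{\mathrm{proj}_{\mathcal Y}(\hat f_n(x)+\hat\varepsilon^i_n)} .$$ Wasserstein ER-DRO. $\mathcal P(\mathcal Y)$ is the set of probability distributions supported in $\mathcal Y$; $d_{W,p}(Q_1,Q_2):=\big(\inf_\pi\int\|y_1-y_2\|^p\,d\pi\big)^{1/p}$, infimum over couplings $\pi$ of $Q_1,Q_2$. For $\zeta\ge0$, $\hat{\mathcal P}_n(x;\zeta):=\{Q\in\mathcal P(\mathcal Y): d_{W,p}(Q,\hat P^{ER}_n(x))\le\zeta\}$. The ER-DRO problem is $\hat v^{DRO}_n(x)=\min_{z\in\mathcal Z}\sup_{Q\in\hat{\mathcal P}_n(x;\zeta)}\mathbb E_{Y\sim Q}[c(z,Y)]$, whose objective is assumed real-valued and lower semicontinuous on $\mathcal Z$ for each $x$; $\hat z^{DRO}_n(x)$ denotes an optimal solution. Radius (for a risk level $\alpha\in(0,1)$). Let $C\ge1$, $c_0>0$ be the constants (depending only on $a$, $d_y$ and $\mathbb E[\exp(\|\varepsilon\|^a)]$) of the measure concentration inequality, quoted from the literature, $$\mathbb P\{d_{W,p}(P^*_n(x),P_{Y\mid X=x})\ge\kappa\}\le\begin{cases}C\exp(-c_0n\kappa^{\max\{d_y/p,2\}}),&\kappa\le1,\\ C\exp(-c_0n\kappa^{a/p}),&\kappa>1,\end{cases}$$ for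 all $\kappa>0$, $n\in\mathbb N$, $x\in\mathcal X$. Setting the right-hand side equal to $\alpha/2$ gives $$\kappa^{(2)}_{p,n}(\alpha):=\begin{cases}\big(\tfrac{\log(2C/\alpha)}{c_0n}\big)^{\min\{p/d_y,1/2\}},&n\ge\log(2C/\alpha)/c_0,\\ \big(\tfrac{\log(2C/\alpha)}{c_0n}\big)^{p/a},&n<\log(2C/\alpha)/c_0.\end{cases}$$ The radius is $\zeta_n(\alpha,x):=2\kappa_{p,n}(\alpha/4,x)+\kappa^{(2)}_{p,n}(\alpha)$, where $\kappa_{p,n}$ are the constants of hypothesis (ii).
   Formalization: The constants κ_{p,n} of (ii) are a suitably chosen family satisfying (ii), fixed before x, η, Γ, γ; the claim is proved for that choice, as it fails for arbitrary families satisfying (ii), e.g. very large constants κ_{p,n}. *)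

theory Defs
  imports "HOL-Probability.Probability"
begin

definition msupport :: "'a::topological_space measure \<Rightarrow> 'a set" where
  "msupport \<mu> = {x. \<forall>U. open U \<and> x \<in> U \<longrightarrow> 0 < emeasure \<mu> U}"

definition lsc_on :: "'a::topological_space set \<Rightarrow> ('a \<Rightarrow> real) \<Rightarrow> bool" where
  "lsc_on S f \<longleftrightarrow> (\<forall>x\<in>S. \<forall>t<f x. \<forall>\<^sub>F u in at x within S. t < f u)"

definition couplings ::
    "'a::euclidean_space measure \<Rightarrow> 'a measure \<Rightarrow> ('a \<times> 'a) measure set" where
  "couplings Q\<^sub>1 Q\<^sub>2 =
     {\<pi>. prob_space \<pi> \<and> sets \<pi> = sets (borel \<Otimes>\<^sub>M borel) \<and>
         distr \<pi> borel fst = Q\<^sub>1 \<and> distr \<pi> borel snd = Q\<^sub>2}"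

text \<open>The Wasserstein distance of order \<open>p\<close> takes values in the extended nonnegative reals: it is
  infinite if no coupling has finite \<open>p\<close>-cost. The case split is only there because \<open>powr\<close> is
  not available on \<^typ>\<open>ennreal\<close>.\<close>

definition wasserstein ::
    "real \<Rightarrow> 'a::euclidean_space measure \<Rightarrow> 'a measure \<Rightarrow> ennreal" where
  "wasserstein p Q\<^sub>1 Q\<^sub>2 =
     (let T = (INF \<pi>\<in>couplings Q\<^sub>1 Q\<^sub>2. \<integral>\<^sup>+ (y\<^sub>1, y\<^sub>2). ennreal (norm (y\<^sub>1 - y\<^sub>2) powr p) \<partial>\<pi>)
      in if T = top then top else ennreal (enn2real T powr (1 / p)))"

definition prob_measures_on :: "'a::euclidean_space set \<Rightarrow> 'a measure set" where
  "prob_measures_on S = {Q. prob_space Q \<and> sets Q = sets borel \<and> (AE y in Q. y \<in> S)}"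

definition wasserstein_ball ::
    "'a::euclidean_space set \<Rightarrow> real \<Rightarrow> 'a measure \<Rightarrow> real \<Rightarrow> 'a measure set" where
  "wasserstein_ball S p P \<zeta> = {Q \<in> prob_measures_on S. wasserstein p Q P \<le> ennreal \<zeta>}"

text \<open>\<open>(1/n) \<Sum>\<^sub>i \<delta>\<^bsub>u i\<^esub>\<close> with \<open>i = 1, \<dots>, n\<close>.\<close>

definition empirical :: "nat \<Rightarrow> (nat \<Rightarrow> 'a::euclidean_space) \<Rightarrow> 'a measure" where
  "empirical n u = distr (uniform_count_measure {1..n}) borel u"

text \<open>A regression method \<open>R\<close> turns the data \<open>(y\<^sup>i, x\<^sup>i)\<close>, \<open>1 \<le> i \<le> n\<close>, into an estimate of the
  regression function; \<open>estimate R n xs ys \<omega>\<close> is the estimate computed from the data observed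
  in the outcome \<open>\<omega>\<close>.\<close>

definition estimate ::
    "(nat \<Rightarrow> (nat \<Rightarrow> 'b \<times> 'a) \<Rightarrow> 'a \<Rightarrow> 'b) \<Rightarrow> nat \<Rightarrow> (nat \<Rightarrow> 'w \<Rightarrow> 'a) \<Rightarrow> (nat \<Rightarrow> 'w \<Rightarrow> 'b) \<Rightarrow>
     'w \<Rightarrow> 'a \<Rightarrow> 'b" where
  "estimate R n xs ys \<omega> = R n (\<lambda>i\<in>{1..n}. (ys i \<omega>, xs i \<omega>))"

text \<open>The empirical residuals distribution: its atoms are the projections onto \<open>S\<close> of
  \<open>f x\<close> plus the residuals \<open>y\<^sup>i - f (x\<^sup>i)\<close>.\<close>

definition er_empirical ::
    "'b::euclidean_space set \<Rightarrow> nat \<Rightarrow> ('a \<Rightarrow> 'b) \<Rightarrow> (nat \<Rightarrow> 'a) \<Rightarrow> (nat \<Rightarrow> 'b) \<Rightarrow> 'a \<Rightarrow> 'b measure"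
  where
  "er_empirical S n f xv yv x =
     empirical n (\<lambda>i. closest_point S (f x + (yv i - f (xv i))))"

text \<open>\<open>c z y\<close> is meaningful only for \<open>y \<in> S\<close>, hence integrals of the cost under a law carried
  by \<open>S\<close> are taken over the set \<open>S\<close>.\<close>

definition expected_cost ::
    "'b::euclidean_space set \<Rightarrow> ('c \<Rightarrow> 'b \<Rightarrow> real) \<Rightarrow> 'b measure \<Rightarrow> 'c \<Rightarrow> real" where
  "expected_cost S c Q z = (LINT y:S|Q. c z y)"

definition worst_case_cost ::
    "'b::euclidean_space set \<Rightarrow> real \<Rightarrow> ('c \<Rightarrow> 'b \<Rightarrow> real) \<Rightarrow> 'b measure \<Rightarrow> real \<Rightarrow> 'c \<Rightarrow> real" where
  "worst_case_cost S p c P \<zeta> z = (SUP Q\<in>wasserstein_ball S p P \<zeta>. expected_cost S c Q z)"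

text \<open>A supremum of real numbers is meaningful only if the set is bounded, and a Bochner integral
  only if the integrand is integrable.\<close>

definition worst_case_real ::
    "'b::euclidean_space set \<Rightarrow> real \<Rightarrow> ('c \<Rightarrow> 'b \<Rightarrow> real) \<Rightarrow> 'b measure \<Rightarrow> real \<Rightarrow> 'c \<Rightarrow> bool" where
  "worst_case_real S p c P \<zeta> z \<longleftrightarrow>
     (\<forall>Q\<in>wasserstein_ball S p P \<zeta>. set_integrable Q S (c z)) \<and>
     bdd_above ((\<lambda>Q. expected_cost S c Q z) ` wasserstein_ball S p P \<zeta>)"

definition minimizers :: "'c set \<Rightarrow> ('c \<Rightarrow> real) \<Rightarrow> 'c set" where
  "minimizers Z h = {z. is_arg_min h (\<lambda>z. z \<in> Z) z}"

text \<open>The threshold \<open>k\<close> bounds, with risk \<open>\<alpha>\<close> each, the estimation error at \<open>x\<close> and the mean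
  estimation error at the covariate samples.\<close>

definition error_threshold ::
    "'w measure \<Rightarrow> ('a \<Rightarrow> 'b::euclidean_space) \<Rightarrow> ('w \<Rightarrow> 'a \<Rightarrow> 'b) \<Rightarrow> (nat \<Rightarrow> 'w \<Rightarrow> 'a) \<Rightarrow>
     real \<Rightarrow> nat \<Rightarrow> real \<Rightarrow> 'a \<Rightarrow> real \<Rightarrow> bool" where
  "error_threshold M f fh xs p n \<alpha> x k \<longleftrightarrow>
     0 < k \<and>
     \<P>(\<omega> in M. norm (f x - fh \<omega> x) powr p > k powr p) \<le> \<alpha> \<and>
     \<P>(\<omega> in M. (\<Sum>i=1..n. norm (f (xs i \<omega>) - fh \<omega> (xs i \<omega>)) powr p) / real n > k powr p) \<le> \<alpha>"

definition concentration_rate ::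
    "real \<Rightarrow> real \<Rightarrow> real \<Rightarrow> real \<Rightarrow> real \<Rightarrow> nat \<Rightarrow> real \<Rightarrow> real" where
  "concentration_rate C c\<^sub>0 p a d n k =
     (if k \<le> 1 then C * exp (- (c\<^sub>0 * real n * k powr max (d / p) 2))
      else C * exp (- (c\<^sub>0 * real n * k powr (a / p))))"

text \<open>For \<open>0 < \<alpha> < 2 * C\<close>, the positive solution \<open>k\<close> of \<open>concentration_rate C c\<^sub>0 p a d n k = \<alpha> / 2\<close>.\<close>

definition concentration_radius ::
    "real \<Rightarrow> real \<Rightarrow> real \<Rightarrow> real \<Rightarrow> real \<Rightarrow> nat \<Rightarrow> real \<Rightarrow> real" where
  "concentration_radius C c\<^sub>0 p a d n \<alpha> =
     (if real n \<ge> ln (2 * C / \<alpha>) / c\<^sub>0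
      then (ln (2 * C / \<alpha>) / (c\<^sub>0 * real n)) powr min (p / d) (1 / 2)
      else (ln (2 * C / \<alpha>) / (c\<^sub>0 * real n)) powr (p / a))"

definition dro_radius ::
    "(nat \<Rightarrow> real \<Rightarrow> 'a \<Rightarrow> real) \<Rightarrow> real \<Rightarrow> real \<Rightarrow> real \<Rightarrow> real \<Rightarrow> real \<Rightarrow> nat \<Rightarrow> real \<Rightarrow> 'a \<Rightarrow> real" where
  "dro_radius \<kappa> C c\<^sub>0 p a d n \<alpha> x = 2 * \<kappa> n (\<alpha> / 4) x + concentration_radius C c\<^sub>0 p a d n \<alpha>"

end

theory Submission
  imports Defs
begin

text \<open>Outside an event of probability at most \<open>\<alpha>\<close> the true conditional law lies in the Wasserstein ball:
  its distance to the empirical measure of the exact errors is controlled by the concentration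
  inequality, and that measure is coupled with the residual measure atom by atom. On this event the
  true cost of the robust solution is at most the worst-case cost at a true minimizer \<open>z\<close>, and this
  exceeds the optimal value by little once the radius is small, because integrals of a continuous
  function of \<open>p\<close>-growth are continuous with respect to the Wasserstein distance. By compactness, points
  at distance at least \<open>\<eta>\<close> from the minimizers miss the optimal value by a fixed gap. With
  \<open>\<alpha> = \<Gamma> exp (- n \<gamma>)\<close>, \<open>\<Gamma>\<close> large and \<open>\<gamma>\<close> small, the exponential bounds make the radius
  as small as desired, uniformly in \<open>n\<close>.\<close>

text \<open>Condition (ii) also admits thresholds that are far too large, and with those the radius
  would not shrink. The conclusion lets the family \<open>\<kappa>\<close> be chosen, and it is
  chosen nearly minimal at every \<open>n\<close>, \<alpha> and \<open>x\<close>. A fixed small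
  tolerance \<open>\<delta>\<close>, admissible at level \<alpha>/4 by (iii), is then a competitor
  and bounds the chosen threshold from above. Two couplings with a common marginal have to be
  combined twice: to pass from the exact errors to the residuals, and to compare a member
  \<open>Q\<close> of the ball with the true law. Gluing them in general takes a disintegration. In
  the first case the common marginal has finitely many atoms, and a random index does the gluing
  explicitly; in the second a dual potential separates the couplings. Smallness of the radius is
  used for one cost function only, that of a fixed true minimizer \<open>z\<close>. At the robust
  solution the single fact that the true law lies in the ball suffices, so no modulus uniform over
  \<open>Z\<close> enters.\<close>

section \<open>Minkowski's inequality and near-optimal couplings\<close>

text \<open>Convexity of the \<open>p\<close>-th power at the points \<open>a / A\<close> and
  \<open>b / B\<close> with weights \<open>A / (A + B)\<close> and \<open>B / (A + B)\<close>,
  rescaled. The free parameters are meant to be bounds on two Lp-norms; \<open>A = B = 1\<close>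
  gives the familiar factor \<open>2 powr (p - 1)\<close>.\<close>

lemma powr_add_le_weighted:
  fixes a b A B p :: real
  assumes "p \<ge> 1" "a \<ge> 0" "b \<ge> 0" "A > 0" "B > 0"
  shows "(a + b) powr p \<le> (A + B) powr (p - 1) * (A powr (1 - p) * a powr p + B powr (1 - p) * b powr p)"
proof -
  have half: "b powr p \<le> (A + B) powr (p - 1) * (B powr (1 - p) * b powr p)"
    if "A > 0" "B > 0" for A B b :: real
  proof -
    have "1 \<le> ((A + B) / B) powr (p - 1)"
      using that \<open>p \<ge> 1\<close> by (intro ge_one_powr_ge_zero) auto
    also have "\<dots> = (A + B) powr (p - 1) * B powr (1 - p)"
      using that by (simp add: powr_divide powr_diff field_simps)
    finally have "1 * b powr p \<le> (A + B) powr (p - 1) * B powr (1 - p) * b powr p"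
      by (intro mult_right_mono) auto
    thus ?thesis by (simp add: mult.assoc)
  qed
  consider "a = 0" | "b = 0" | "a > 0" "b > 0" using assms by fastforce
  thus ?thesis
  proof cases
    case 1
    thus ?thesis using half[of A B b] assms by simp
  next
    case 2
    thus ?thesis using half[of B A a] assms by (simp add: add.commute)
  next
    case 3
    define t where "t = B / (A + B)"
    have t: "0 \<le> t" "t \<le> 1" "1 - t = A / (A + B)"
      using assms by (auto simp: t_def field_simps)
    have "((1 - t) *\<^sub>R (a / A) + t *\<^sub>R (b / B)) powr p
        \<le> (1 - t) * (a / A) powr p + t * (b / B) powr p"
      using convex_onD[OF powr_convex[OF \<open>p \<ge> 1\<close>] t(1,2), of "a / A" "b / B"] assms 3 by auto
    moreover have "(1 - t) *\<^sub>R (a / A) + t *\<^sub>R (b / B) = (a + b) / (A + B)"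
      unfolding t(3) using assms by (simp add: t_def add_divide_distrib)
    ultimately have le: "((a + b) / (A + B)) powr p
        \<le> (A / (A + B)) * (a / A) powr p + (B / (A + B)) * (b / B) powr p"
      unfolding t(3) by (simp add: t_def)
    have "(a + b) powr p = (A + B) powr p * ((a + b) / (A + B)) powr p"
      using assms by (simp flip: powr_mult)
    also have "\<dots> \<le> (A + B) powr p * ((A / (A + B)) * (a / A) powr p + (B / (A + B)) * (b / B) powr p)"
      using le by (intro mult_left_mono) auto
    also have "\<dots> = (A + B) powr (p - 1) * (A powr (1 - p) * a powr p + B powr (1 - p) * b powr p)"
    proof -
      define q where "q = A + B"
      have "q > 0" using assms by (simp add: q_def)
      thus ?thesis using assms unfolding q_def[symmetric]
        by (simp add: powr_diff powr_divide add_divide_distrib distrib_left mult.commute)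
    qed
    finally show ?thesis .
  qed
qed

text \<open>With the two norm bounds as weights, the pointwise convexity estimate integrates to
  exactly \<open>(A + B) powr p\<close>, so Hoelder's inequality is bypassed.\<close>

lemma nn_integral_minkowski:
  fixes f g :: "'a \<Rightarrow> real"
  assumes "p \<ge> 1" "A > 0" "B > 0"
    and [measurable]: "f \<in> borel_measurable N" "g \<in> borel_measurable N"
    and "\<And>x. f x \<ge> 0" "\<And>x. g x \<ge> 0"
    and fA: "(\<integral>\<^sup>+ x. ennreal (f x powr p) \<partial>N) \<le> ennreal (A powr p)"
    and gB: "(\<integral>\<^sup>+ x. ennreal (g x powr p) \<partial>N) \<le> ennreal (B powr p)"
  shows "(\<integral>\<^sup>+ x. ennreal ((f x + g x) powr p) \<partial>N) \<le> ennreal ((A + B) powr p)"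
proof -
  let ?s = "(A + B) powr (p - 1)"
  have "(\<integral>\<^sup>+ x. ennreal ((f x + g x) powr p) \<partial>N)
      \<le> (\<integral>\<^sup>+ x. ennreal (?s * A powr (1 - p)) * ennreal (f x powr p)
             + ennreal (?s * B powr (1 - p)) * ennreal (g x powr p) \<partial>N)"
    using assms
    by (intro nn_integral_mono)
       (auto simp: algebra_simps simp flip: ennreal_mult ennreal_plus intro!: ennreal_leI
          order_trans[OF powr_add_le_weighted[of p _ _ A B]])
  also have "\<dots> = ennreal (?s * A powr (1 - p)) * (\<integral>\<^sup>+ x. ennreal (f x powr p) \<partial>N)
      + ennreal (?s * B powr (1 - p)) * (\<integral>\<^sup>+ x. ennreal (g x powr p) \<partial>N)"
    by (simp add: nn_integral_add nn_integral_cmult)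
  also have "\<dots> \<le> ennreal (?s * A powr (1 - p)) * ennreal (A powr p)
      + ennreal (?s * B powr (1 - p)) * ennreal (B powr p)"
    using fA gB by (intro add_mono mult_left_mono) auto
  also have "\<dots> = ennreal (?s * (A powr (1 - p) * A powr p + B powr (1 - p) * B powr p))"
    by (simp add: algebra_simps flip: ennreal_mult ennreal_plus)
  also have "?s * (A powr (1 - p) * A powr p + B powr (1 - p) * B powr p) = (A + B) powr p"
    using assms by (simp add: powr_diff flip: powr_add)
  finally show ?thesis .
qed

text \<open>The strict inequality yields an actual coupling, so the infimum need not be attained.
  The price is an arbitrarily small enlargement of the radius wherever only a weak bound is
  known.\<close>

lemma coupling_of_wasserstein_less:
  assumes "wasserstein p Q\<^sub>1 Q\<^sub>2 < ennreal s" "p > 0"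
  obtains \<pi> where "\<pi> \<in> couplings Q\<^sub>1 Q\<^sub>2"
    "(\<integral>\<^sup>+ (y\<^sub>1, y\<^sub>2). ennreal (norm (y\<^sub>1 - y\<^sub>2) powr p) \<partial>\<pi>) \<le> ennreal (s powr p)"
proof -
  define T where "T = (INF \<pi>\<in>couplings Q\<^sub>1 Q\<^sub>2. \<integral>\<^sup>+ (y\<^sub>1, y\<^sub>2). ennreal (norm (y\<^sub>1 - y\<^sub>2) powr p) \<partial>\<pi>)"
  have w: "(if T = top then top else ennreal (enn2real T powr (1 / p))) < ennreal s"
    using assms(1) unfolding wasserstein_def T_def Let_def .
  hence fin: "T \<noteq> top" by (auto split: if_splits)
  hence "enn2real T powr (1 / p) < s" using w by (auto simp: ennreal_less_iff)
  hence "(enn2real T powr (1 / p)) powr p < s powr p"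
    using assms(2) by (intro powr_less_mono2) auto
  hence "enn2real T < s powr p" using assms(2) by (simp add: powr_powr)
  hence "T < ennreal (s powr p)"
    by (metis fin ennreal_enn2real_if ennreal_lessI enn2real_nonneg less_le_trans linorder_not_less)
  thus ?thesis unfolding T_def Inf_less_iff using that by (force intro: less_imp_le)
qed

lemma wasserstein_le_of_coupling:
  assumes "\<pi> \<in> couplings Q\<^sub>1 Q\<^sub>2" "p > 0" "s \<ge> 0"
    "(\<integral>\<^sup>+ (y\<^sub>1, y\<^sub>2). ennreal (norm (y\<^sub>1 - y\<^sub>2) powr p) \<partial>\<pi>) \<le> ennreal (s powr p)"
  shows "wasserstein p Q\<^sub>1 Q\<^sub>2 \<le> ennreal s"
proof -
  define T where "T = (INF \<pi>\<in>couplings Q\<^sub>1 Q\<^sub>2. \<integral>\<^sup>+ (y\<^sub>1, y\<^sub>2). ennreal (norm (y\<^sub>1 - y\<^sub>2) powr p) \<partial>\<pi>)"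
  have T: "T \<le> ennreal (s powr p)"
    unfolding T_def using assms(1,4) by (rule INF_lower2)
  hence fin: "T \<noteq> top" by (auto simp: top_unique)
  have "enn2real T \<le> s powr p" using T by (simp add: enn2real_leI)
  hence "enn2real T powr (1 / p) \<le> (s powr p) powr (1 / p)"
    using assms(2) by (intro powr_mono2) auto
  also have "\<dots> = s" using assms by (simp add: powr_powr)
  finally show ?thesis using fin unfolding wasserstein_def T_def[symmetric] Let_def
    by (auto intro: ennreal_leI)
qed

section \<open>Lower semicontinuous functions on compact sets\<close>

lemma lsc_on_subset: "lsc_on S f \<Longrightarrow> T \<subseteq> S \<Longrightarrow> lsc_on T f"
  unfolding lsc_on_def by (meson at_le filter_leD in_mono)

text \<open>Without a minimizer every \<open>z\<close> has a strictly better point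
  \<open>u z\<close>, and by semicontinuity a whole neighbourhood of \<open>z\<close> stays above
  \<open>g (u z)\<close>. Among the finitely many values \<open>g (u z)\<close> of a subcover the
  least one is undercut, since its own point \<open>u z\<close> lies in some neighbourhood of the
  subcover.\<close>

lemma lsc_on_attains_min:
  fixes g :: "'a::topological_space \<Rightarrow> real"
  assumes "compact Z" "Z \<noteq> {}" "lsc_on Z g"
  obtains z where "z \<in> Z" "\<And>u. u \<in> Z \<Longrightarrow> g z \<le> g u"
proof (rule ccontr)
  assume "\<not> thesis"
  hence "\<forall>z\<in>Z. \<exists>u\<in>Z. g u < g z" using that by (meson not_le)
  then obtain u where u: "\<And>z. z \<in> Z \<Longrightarrow> u z \<in> Z \<and> g (u z) < g z" by metis
  have "\<exists>U. open U \<and> z \<in> U \<and> (\<forall>w\<in>U \<inter> Z. g (u z) < g w)" if "z \<in> Z" for z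
  proof -
    have "\<forall>\<^sub>F w in at z within Z. g (u z) < g w"
      using assms(3) u[OF that] that unfolding lsc_on_def by blast
    then obtain U where "open U" "z \<in> U" "\<forall>w\<in>U. w \<noteq> z \<longrightarrow> w \<in> Z \<longrightarrow> g (u z) < g w"
      unfolding eventually_at_topological by blast
    moreover have "g (u z) < g z" using u[OF that] by blast
    ultimately show ?thesis by (intro exI[of _ U]) (metis IntE)
  qed
  then obtain U where U: "\<And>z. z \<in> Z \<Longrightarrow> open (U z) \<and> z \<in> U z \<and> (\<forall>w\<in>U z \<inter> Z. g (u z) < g w)"
    by metis
  obtain F where F: "F \<subseteq> Z" "finite F" "Z \<subseteq> (\<Union>z\<in>F. U z)"
    by (rule compactE_image[OF assms(1), of Z U]) (use U in auto)
  have "F \<noteq> {}" using F assms(2) by auto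
  define m where "m = Min ((\<lambda>z. g (u z)) ` F)"
  have "m \<in> (\<lambda>z. g (u z)) ` F" unfolding m_def using F \<open>F \<noteq> {}\<close> by (intro Min_in) auto
  then obtain z where z: "z \<in> F" "m = g (u z)" by auto
  then obtain z' where z': "z' \<in> F" "u z \<in> U z'" using F u by blast
  have "g (u z') < g (u z)" using U z' F u z by blast
  moreover have "m \<le> g (u z')" unfolding m_def using z' F by (intro Min_le) auto
  ultimately show False using z by simp
qed

text \<open>The far points form a compact set, so \<open>g\<close> attains its least value there, at
  a non-minimizer because minimizers have distance zero to their own set. Half of the excess keeps
  the inequality strict; if no point is far away, any gap will do.\<close>

lemma minimizers_gap:
  fixes g :: "'a::metric_space \<Rightarrow> real"
  assumes "compact Z" "lsc_on Z g" "\<eta> > 0" "z \<in> minimizers Z g"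
  obtains \<Delta> where "\<Delta> > 0" "\<And>u. u \<in> Z \<Longrightarrow> infdist u (minimizers Z g) \<ge> \<eta> \<Longrightarrow> g z + \<Delta> < g u"
proof -
  define A where "A = Z \<inter> {u. infdist u (minimizers Z g) \<ge> \<eta>}"
  have z: "z \<in> Z" "\<And>u. u \<in> Z \<Longrightarrow> g z \<le> g u"
    using assms(4) by (auto simp: minimizers_def is_arg_min_def not_less)
  have "closed {u. infdist u (minimizers Z g) \<ge> \<eta>}"
    by (intro closed_Collect_le continuous_intros)
  hence A: "compact A" unfolding A_def using assms(1) by (intro compact_Int_closed)
  show thesis
  proof (cases "A = {}")
    case True
    show ?thesis by (rule that[of 1]) (use True in \<open>auto simp: A_def\<close>)
  next
    case False
    obtain w where w: "w \<in> A" "\<And>u. u \<in> A \<Longrightarrow> g w \<le> g u"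
      using lsc_on_attains_min[OF A False lsc_on_subset[OF assms(2)]] A_def by auto
    have "w \<notin> minimizers Z g"
      using w(1) assms(3) by (auto simp: A_def)
    hence "g z < g w" using w(1) z
      by (force simp: minimizers_def is_arg_min_def not_less A_def)
    show ?thesis
      by (rule that[of "(g w - g z) / 2"]) (use \<open>g z < g w\<close> w(2) in \<open>force simp: A_def field_simps\<close>)+
  qed
qed

section \<open>Topological supports\<close>

lemma closed_msupport: "closed (msupport \<mu>)"
proof -
  have "- msupport \<mu> = \<Union> {U. open U \<and> emeasure \<mu> U = 0}"
    unfolding msupport_def by (auto simp: zero_less_iff_neq_zero)
  moreover have "open (\<Union> {U. open U \<and> emeasure \<mu> U = 0})" by auto
  ultimately show ?thesis by (simp add: closed_def)
qed

text \<open>The complement of the support is the union of all open null sets; by the Lindeloef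
  property countably many of them already cover it.\<close>

lemma AE_msupport:
  fixes \<mu> :: "'a::second_countable_topology measure"
  assumes [simp]: "sets \<mu> = sets borel"
  shows "AE x in \<mu>. x \<in> msupport \<mu>"
proof -
  let ?F = "{U. open U \<and> emeasure \<mu> U = 0}"
  obtain F where F: "F \<subseteq> ?F" "countable F" "\<Union> F = \<Union> ?F"
    by (rule Lindelof[of ?F]) auto
  have "F \<subseteq> null_sets \<mu>" using F by (auto simp: null_sets_def)
  hence "\<Union> F \<in> null_sets \<mu>"
    using F(2) null_sets_UN'[of F "\<lambda>x. x" \<mu>] by auto
  moreover have "- msupport \<mu> = \<Union> ?F"
    unfolding msupport_def by (auto simp: zero_less_iff_neq_zero)
  ultimately have "- msupport \<mu> \<in> null_sets \<mu>" using F by simp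
  thus ?thesis by (rule AE_I') auto
qed

section \<open>Empirical measures\<close>

lemma real_card_filter:
  "finite A \<Longrightarrow> real (card {i\<in>A. P i}) = (\<Sum>i\<in>A. if P i then 1 else 0)"
  by (simp add: sum.If_cases Int_def)

lemma sets_empirical [simp, measurable_cong]: "sets (empirical n u) = sets borel"
  by (simp add: empirical_def)

lemma space_empirical [simp]: "space (empirical n u) = UNIV"
  by (simp add: empirical_def)


lemma measurable_uniform_count_measure: "u \<in> borel_measurable (uniform_count_measure A)"
  by (simp add: measurable_def sets_uniform_count_measure space_uniform_count_measure)

lemma emeasure_empirical:
  assumes "n \<ge> 1" "S \<in> sets borel"
  shows "emeasure (empirical n u) S = ennreal (real (card {i\<in>{1..n}. u i \<in> S}) / real n)"
proof -
  have "emeasure (empirical n u) S = emeasure (uniform_count_measure {1..n}) (u -` S \<inter> {1..n})"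
    using assms by (simp add: empirical_def emeasure_distr space_uniform_count_measure
        measurable_uniform_count_measure)
  also have "\<dots> = ennreal (real (card (u -` S \<inter> {1..n})) / real n)"
    by (subst emeasure_uniform_count_measure) auto
  also have "u -` S \<inter> {1..n} = {i\<in>{1..n}. u i \<in> S}" by auto
  finally show ?thesis .
qed

lemma prob_space_empirical:
  assumes "n \<ge> 1" shows "prob_space (empirical n u)"
  unfolding empirical_def using assms
  by (intro prob_space.prob_space_distr prob_space_uniform_count_measure
        measurable_uniform_count_measure) auto

lemma AE_empirical:
  assumes "n \<ge> 1"
  shows "AE y in empirical n u. y \<in> u ` {1..n}"
proof -
  have "finite (u ` {1..n})" by simp
  hence "closed (u ` {1..n})" by (rule finite_imp_closed)
  hence "emeasure (empirical n u) (- (u ` {1..n})) = 0"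
    using assms by (subst emeasure_empirical) auto
  thus ?thesis using \<open>closed (u ` {1..n})\<close>
    by (intro AE_I'[of "- (u ` {1..n})"]) (auto simp: null_sets_def)
qed

section \<open>Couplings with an empirical measure\<close>

lemma couplingsD:
  assumes "\<pi> \<in> couplings Q\<^sub>1 Q\<^sub>2"
  shows "prob_space \<pi>" "sets \<pi> = sets (borel \<Otimes>\<^sub>M borel)" "distr \<pi> borel fst = Q\<^sub>1" "distr \<pi> borel snd = Q\<^sub>2"
  using assms by (auto simp: couplings_def)

text \<open>A triangle inequality through \<open>empirical n u\<close>, in which the second leg is
  the index-wise matching of \<open>u i\<close> with \<open>v i\<close>. The obstacle is that
  \<open>u\<close> may repeat values while \<open>v\<close> does not, so an atom does not determine
  its index; the multiplicity \<open>m\<close> accounts for this.\<close>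

lemma wasserstein_empirical_triangle:
  fixes u v :: "nat \<Rightarrow> 'a::euclidean_space"
  assumes "n \<ge> 1" "p \<ge> 1" "A > 0" "B > 0"
    and \<pi>: "\<pi> \<in> couplings (empirical n u) Q"
    and cost: "(\<integral>\<^sup>+ (y\<^sub>1, y\<^sub>2). ennreal (norm (y\<^sub>1 - y\<^sub>2) powr p) \<partial>\<pi>) \<le> ennreal (A powr p)"
    and uv: "(\<Sum>i=1..n. norm (u i - v i) powr p) / real n \<le> B powr p"
  shows "wasserstein p Q (empirical n v) \<le> ennreal (A + B)"
proof -
  interpret P: prob_space \<pi> using \<pi> by (rule couplingsD)
  have [measurable_cong, simp]: "sets \<pi> = sets (borel \<Otimes>\<^sub>M borel)" using \<pi> by (rule couplingsD)
  have spc [simp]: "space \<pi> = UNIV"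
    using sets_eq_imp_space_eq[OF \<open>sets \<pi> = _\<close>] by (simp add: space_pair_measure)
  define m where "m y = real (card {i\<in>{1..n}. u i = y})" for y
  have m_eq: "m y = (\<Sum>i=1..n. indicator {u i} y)" for y
    unfolding m_def real_card_filter[OF finite_atLeastAtMost] by (intro sum.cong) auto
  have [measurable]: "m \<in> borel_measurable borel"
    unfolding m_eq[abs_def] by measurable
  have m_pos: "m (u j) > 0" if "j \<in> {1..n}" for j
    using that by (auto simp: m_def card_gt_0_iff)
  \<comment> \<open>The first coordinate of \<open>\<pi>\<close> is spread evenly over the indices \<open>j\<close> that produce it; replacing it
    by \<open>v j\<close> turns \<open>\<pi>\<close> into a coupling of \<open>Q\<close> and \<open>empirical n v\<close>, without any disintegration.\<close>
  define h where "h = (\<lambda>j (y :: 'a \<times> 'a). ennreal (indicator {u j} (fst y) / m (fst y)))"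
  have [measurable]: "h j \<in> borel_measurable (borel \<Otimes>\<^sub>M borel)" for j
    unfolding h_def by measurable
  define \<nu> where "\<nu> = count_space {1..n} \<Otimes>\<^sub>M \<pi>"
  note slices = measurable_pair_measure_countable1[OF countable_finite[OF finite_atLeastAtMost[of 1 n]], of _ \<pi>, folded \<nu>_def]
  have hm [measurable]: "(\<lambda>(j, y). h j y) \<in> borel_measurable \<nu>"
    by (rule slices) simp
  \<comment> \<open>\<open>\<rho>\<close> is the joint law of the random index and the pair drawn
    from \<open>\<pi>\<close>; all three points of the triangle inequality are functions on this
    space.\<close>
  define \<rho> where "\<rho> = density \<nu> (\<lambda>(j, y). h j y)"
  have \<rho>_int: "(\<integral>\<^sup>+ x. F x \<partial>\<rho>) = (\<Sum>j=1..n. \<integral>\<^sup>+ y. h j y * F (j, y) \<partial>\<pi>)"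
    if F [measurable]: "F \<in> borel_measurable \<nu>" for F
  proof -
    have "(\<integral>\<^sup>+ x. F x \<partial>\<rho>) = (\<integral>\<^sup>+ x. (\<lambda>(j, y). h j y) x * F x \<partial>\<nu>)"
      unfolding \<rho>_def by (rule nn_integral_density) auto
    also have "\<dots> = (\<integral>\<^sup>+ j. \<integral>\<^sup>+ y. h j y * F (j, y) \<partial>\<pi> \<partial>count_space {1..n})"
      using P.nn_integral_fst[OF borel_measurable_times_ennreal[OF hm F, unfolded \<nu>_def], symmetric]
      by (simp add: \<nu>_def)
    also have "\<dots> = (\<Sum>j=1..n. \<integral>\<^sup>+ y. h j y * F (j, y) \<partial>\<pi>)"
      by (rule nn_integral_count_space_finite) simp
    finally show ?thesis .
  qed
  have AEu: "AE y in \<pi>. fst y \<in> u ` {1..n}"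
    using AE_empirical[OF assms(1), of u] unfolding couplingsD(3)[OF \<pi>, symmetric]
    by (rule AE_distrD[rotated]) simp
  have sum_h: "AE y in \<pi>. (\<Sum>j=1..n. h j y) = 1"
    using AEu
  proof eventually_elim
    case (elim y)
    then obtain j where j: "j \<in> {1..n}" "fst y = u j" by auto
    have "(\<Sum>j=1..n. h j y) = ennreal (\<Sum>j=1..n. indicator {u j} (fst y) / m (fst y))"
      unfolding h_def by (rule sum_ennreal) (simp add: m_def)
    also have "(\<Sum>j=1..n. indicator {u j} (fst y) / m (fst y)) = m (fst y) / m (fst y)"
      by (subst (2) m_eq) (simp add: sum_divide_distrib)
    finally show ?case using m_pos[OF j(1)] j by simp
  qed
  \<comment> \<open>The atom \<open>u j\<close> has mass \<open>m (u j) / n\<close>, shared equally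
    by \<open>m (u j)\<close> indices: every index has probability \<open>1 / n\<close>, which is
    what makes the second marginal \<open>empirical n v\<close>.\<close>
  have int_h: "(\<integral>\<^sup>+ y. h j y \<partial>\<pi>) = ennreal (1 / real n)" if j: "j \<in> {1..n}" for j
  proof -
    have "(\<integral>\<^sup>+ y. h j y \<partial>\<pi>) = (\<integral>\<^sup>+ y. ennreal (1 / m (u j)) * indicator {u j} (fst y) \<partial>\<pi>)"
      by (intro nn_integral_cong) (auto simp: h_def indicator_def)
    also have "\<dots> = ennreal (1 / m (u j)) * (\<integral>\<^sup>+ y. indicator {u j} y \<partial>distr \<pi> borel fst)"
      by (subst nn_integral_distr) (auto simp: nn_integral_cmult simp del: nn_integral_indicator)
    also have "(\<integral>\<^sup>+ y. indicator {u j} y \<partial>distr \<pi> borel fst) = ennreal (m (u j) / real n)"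
      unfolding couplingsD(3)[OF \<pi>] using assms(1) by (simp add: emeasure_empirical m_def)
    also have "ennreal (1 / m (u j)) * \<dots> = ennreal (1 / real n)"
      using m_pos[OF j] assms(1) by (subst ennreal_mult[symmetric]) auto
    finally show ?thesis .
  qed
  have m\<rho>: "measurable \<rho> = measurable \<nu>" 
    by (intro ext measurable_cong_sets) (auto simp: \<rho>_def)
  define q where "q = (\<lambda>x :: nat \<times> 'a \<times> 'a. (snd (snd x), v (fst x)))"
  have q [measurable]: "q \<in> measurable \<nu> (borel \<Otimes>\<^sub>M borel)"
    by (rule slices) (simp add: q_def)
  have q\<rho>: "q \<in> measurable \<rho> (borel \<Otimes>\<^sub>M borel)" using q by (simp add: m\<rho>)
  define \<pi>' where "\<pi>' = distr \<rho> (borel \<Otimes>\<^sub>M borel) q"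
  have \<pi>'_int: "(\<integral>\<^sup>+ x. F x \<partial>\<pi>') = (\<Sum>j=1..n. \<integral>\<^sup>+ y. h j y * F (snd y, v j) \<partial>\<pi>)"
    if F [measurable]: "F \<in> borel_measurable (borel \<Otimes>\<^sub>M borel)" for F
    unfolding \<pi>'_def using q\<rho> q
    by (simp add: nn_integral_distr \<rho>_int) (simp add: q_def)
  have marg1: "distr \<pi>' borel fst = Q"
  proof (rule measure_eqI)
    show s: "sets (distr \<pi>' borel fst) = sets Q"
      using couplingsD(4)[OF \<pi>] by auto
    fix S assume S0: "S \<in> sets (distr \<pi>' borel fst)"
    hence S [measurable]: "S \<in> sets borel" by simp
    have "emeasure (distr \<pi>' borel fst) S = (\<integral>\<^sup>+ x. indicator S x \<partial>distr \<pi>' borel fst)"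
      by simp
    also have "\<dots> = (\<integral>\<^sup>+ x. indicator S (fst x) \<partial>\<pi>')"
      by (rule nn_integral_distr) (auto simp: \<pi>'_def)
    also have "\<dots> = (\<Sum>j=1..n. \<integral>\<^sup>+ y. h j y * indicator S (snd y) \<partial>\<pi>)"
      by (subst \<pi>'_int) auto
    also have "\<dots> = (\<integral>\<^sup>+ y. (\<Sum>j=1..n. h j y) * indicator S (snd y) \<partial>\<pi>)"
      unfolding sum_distrib_right by (rule nn_integral_sum[symmetric]) measurable
    also have "\<dots> = (\<integral>\<^sup>+ y. indicator S (snd y) \<partial>\<pi>)"
      using sum_h by (intro nn_integral_cong_AE) auto
    also have "\<dots> = (\<integral>\<^sup>+ y. indicator S y \<partial>distr \<pi> borel snd)"
      by (rule nn_integral_distr[symmetric]) auto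
    also have "\<dots> = emeasure Q S" unfolding couplingsD(4)[OF \<pi>] using S0 s by (intro nn_integral_indicator) blast
    finally show "emeasure (distr \<pi>' borel fst) S = emeasure Q S" .
  qed
  have marg2: "distr \<pi>' borel snd = empirical n v"
  proof (rule measure_eqI)
    fix S assume "S \<in> sets (distr \<pi>' borel snd)"
    hence S [measurable]: "S \<in> sets borel" by simp
    have "emeasure (distr \<pi>' borel snd) S = (\<integral>\<^sup>+ x. indicator S x \<partial>distr \<pi>' borel snd)"
      by simp
    also have "\<dots> = (\<integral>\<^sup>+ x. indicator S (snd x) \<partial>\<pi>')"
      by (rule nn_integral_distr) (auto simp: \<pi>'_def)
    also have "\<dots> = (\<Sum>j=1..n. \<integral>\<^sup>+ y. h j y * indicator S (v j) \<partial>\<pi>)"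
      by (subst \<pi>'_int) auto
    also have "\<dots> = (\<Sum>j=1..n. ennreal (1 / real n) * ennreal (indicator S (v j)))"
      by (intro sum.cong refl) (auto simp: nn_integral_multc int_h ennreal_indicator)
    also have "\<dots> = ennreal (\<Sum>j=1..n. 1 / real n * indicator S (v j))"
      by (simp flip: ennreal_mult add: sum_ennreal)
    also have "(\<Sum>j=1..n. 1 / real n * indicator S (v j)) = real (card {i\<in>{1..n}. v i \<in> S}) / real n"
      unfolding real_card_filter[OF finite_atLeastAtMost] sum_divide_distrib by (intro sum.cong) auto
    also have "ennreal \<dots> = emeasure (empirical n v) S"
      using assms(1) by (simp add: emeasure_empirical)
    finally show "emeasure (distr \<pi>' borel snd) S = emeasure (empirical n v) S" .
  qed simp
  \<comment> \<open>Total mass one is inherited from the second marginal.\<close>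
  have "prob_space (distr \<pi>' borel snd)"
    unfolding marg2 using assms(1) by (rule prob_space_empirical)
  hence "prob_space \<pi>'" by (rule prob_space_distrD[rotated]) (auto simp: \<pi>'_def)
  hence coup: "\<pi>' \<in> couplings Q (empirical n v)"
    using marg1 marg2 by (auto simp: couplings_def \<pi>'_def)
  define f g where "f = (\<lambda>x :: nat \<times> 'a \<times> 'a. norm (fst (snd x) - snd (snd x)))"
    and "g = (\<lambda>x :: nat \<times> 'a \<times> 'a. norm (u (fst x) - v (fst x)))"
  have fg\<nu>: "f \<in> borel_measurable \<nu>" "g \<in> borel_measurable \<nu>"
    by (rule slices; simp add: f_def g_def)+
  have fp: "(\<lambda>x. ennreal (f x powr p)) \<in> borel_measurable \<nu>" "(\<lambda>x. ennreal (g x powr p)) \<in> borel_measurable \<nu>"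
    "(\<lambda>x. ennreal ((f x + g x) powr p)) \<in> borel_measurable \<nu>"
    using fg\<nu> by measurable
  have "(\<integral>\<^sup>+ x. ennreal (f x powr p) \<partial>\<rho>)
      = (\<Sum>j=1..n. \<integral>\<^sup>+ y. h j y * ennreal (norm (fst y - snd y) powr p) \<partial>\<pi>)"
    using fp by (subst \<rho>_int) (auto simp: f_def)
  also have "\<dots> = (\<integral>\<^sup>+ y. (\<Sum>j=1..n. h j y) * ennreal (norm (fst y - snd y) powr p) \<partial>\<pi>)"
    unfolding sum_distrib_right by (rule nn_integral_sum[symmetric]) measurable
  also have "\<dots> = (\<integral>\<^sup>+ y. ennreal (norm (fst y - snd y) powr p) \<partial>\<pi>)"
    using sum_h by (intro nn_integral_cong_AE) auto
  also have "\<dots> \<le> ennreal (A powr p)" using cost by (simp add: case_prod_unfold)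
  finally have fA: "(\<integral>\<^sup>+ x. ennreal (f x powr p) \<partial>\<rho>) \<le> ennreal (A powr p)" .
  have "(\<integral>\<^sup>+ x. ennreal (g x powr p) \<partial>\<rho>)
      = (\<Sum>j=1..n. \<integral>\<^sup>+ y. h j y * ennreal (norm (u j - v j) powr p) \<partial>\<pi>)"
    using fp by (subst \<rho>_int) (auto simp: g_def)
  also have "\<dots> = (\<Sum>j=1..n. ennreal (1 / real n) * ennreal (norm (u j - v j) powr p))"
    by (intro sum.cong refl) (auto simp: nn_integral_multc int_h)
  also have "\<dots> = ennreal ((\<Sum>j=1..n. norm (u j - v j) powr p) / real n)"
    by (simp flip: ennreal_mult add: sum_ennreal sum_divide_distrib)
  also have "\<dots> \<le> ennreal (B powr p)" using uv by (rule ennreal_leI)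
  finally have gB: "(\<integral>\<^sup>+ x. ennreal (g x powr p) \<partial>\<rho>) \<le> ennreal (B powr p)" .
  have "(\<integral>\<^sup>+ (y\<^sub>1, y\<^sub>2). ennreal (norm (y\<^sub>1 - y\<^sub>2) powr p) \<partial>\<pi>')
      = (\<Sum>j=1..n. \<integral>\<^sup>+ y. h j y * ennreal (norm (snd y - v j) powr p) \<partial>\<pi>)"
    by (subst \<pi>'_int) auto
  also have "\<dots> \<le> (\<Sum>j=1..n. \<integral>\<^sup>+ y. h j y * ennreal ((f (j, y) + g (j, y)) powr p) \<partial>\<pi>)"
  proof (intro sum_mono nn_integral_mono)
    fix j y
    show "h j y * ennreal (norm (snd y - v j) powr p) \<le> h j y * ennreal ((f (j, y) + g (j, y)) powr p)"
    \<comment> \<open>The pointwise triangle inequality passes through \<open>u j\<close>, hence is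
      valid only if \<open>u j\<close> is the first coordinate; everywhere else the weight
      \<open>h j y\<close> vanishes.\<close>
    proof (cases "fst y = u j")
      case True
      have "norm (snd y - v j) \<le> f (j, y) + g (j, y)"
        using norm_triangle_ineq[of "snd y - u j" "u j - v j"] True
        by (simp add: f_def g_def norm_minus_commute)
      thus ?thesis using assms(2) by (intro mult_left_mono ennreal_leI powr_mono2) auto
    qed (simp add: h_def)
  qed
  also have "\<dots> = (\<integral>\<^sup>+ x. ennreal ((f x + g x) powr p) \<partial>\<rho>)"
    using fp by (subst \<rho>_int) auto
  also have "\<dots> \<le> ennreal ((A + B) powr p)"
    by (rule nn_integral_minkowski[OF assms(2-4) _ _ _ _ fA gB])
       (use fg\<nu> in \<open>auto simp: m\<rho> f_def g_def\<close>)
  finally show ?thesis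
    using coup assms by (intro wasserstein_le_of_coupling) auto
qed

section \<open>Stability of expectations under small Wasserstein distances\<close>

lemma powr_add_le:
  fixes a b p :: real
  assumes "p \<ge> 1" "a \<ge> 0" "b \<ge> 0"
  shows "(a + b) powr p \<le> 2 powr p * (a powr p + b powr p)"
proof -
  have "(a + b) powr p \<le> 2 powr (p - 1) * (a powr p + b powr p)"
    using powr_add_le_weighted[OF assms, of 1 1] by simp
  also have "\<dots> \<le> 2 powr p * (a powr p + b powr p)"
    by (intro mult_right_mono) auto
  finally show ?thesis .
qed

text \<open>The easy half of Kantorovich duality: the pointwise bound by a potential plus the
  transport cost is integrated along the coupling.\<close>

lemma coupling_empirical_integral_le:
  fixes v :: "nat \<Rightarrow> 'a::euclidean_space" and h :: "'a \<Rightarrow> real"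
  assumes "n \<ge> 1" and \<pi>: "\<pi> \<in> couplings Q (empirical n v)"
    and cost: "(\<integral>\<^sup>+ (y\<^sub>1, y\<^sub>2). ennreal (norm (y\<^sub>1 - y\<^sub>2) powr p) \<partial>\<pi>) \<le> ennreal D" and "D \<ge> 0"
    and S: "AE y in Q. y \<in> S" and h: "set_integrable Q S h" and "C \<ge> 0"
    and le: "\<And>y i. y \<in> S \<Longrightarrow> i \<in> {1..n} \<Longrightarrow> h y \<le> \<phi> (v i) + C * norm (y - v i) powr p"
  shows "(LINT y:S|Q. h y) \<le> (\<Sum>i=1..n. \<phi> (v i)) / real n + C * D"
proof -
  have [measurable_cong, simp]: "sets \<pi> = sets (borel \<Otimes>\<^sub>M borel)" using \<pi> by (rule couplingsD)
  interpret P: prob_space \<pi> using \<pi> by (rule couplingsD)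
  \<comment> \<open>The potential may be an arbitrary, possibly nonmeasurable function. Only its
    values at the atoms count, so it is replaced by a finite combination of indicators; summing over
    the image set counts repeated atoms once.\<close>
  define \<phi>' where "\<phi>' = (\<lambda>y. \<Sum>a\<in>v ` {1..n}. \<phi> a * indicator {a} y)"
  have [measurable]: "\<phi>' \<in> borel_measurable borel" unfolding \<phi>'_def by measurable
  have \<phi>'_atom: "\<phi>' (v i) = \<phi> (v i)" if "i \<in> {1..n}" for i
  proof -
    have "\<phi>' (v i) = (\<Sum>a\<in>v ` {1..n}. if a = v i then \<phi> a else 0)"
      unfolding \<phi>'_def by (intro sum.cong) auto
    also have "\<dots> = \<phi> (v i)" using that by (subst sum.delta) auto
    finally show ?thesis .
  qed
  have "\<bar>\<phi>' y\<bar> \<le> (\<Sum>a\<in>v ` {1..n}. \<bar>\<phi> a\<bar>)" for y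
    unfolding \<phi>'_def by (intro order_trans[OF sum_abs] sum_mono) (auto simp: indicator_def)
  hence int\<phi>: "integrable \<pi> (\<lambda>x. \<phi>' (snd x))"
    by (intro P.integrable_const_bound[of _ "\<Sum>a\<in>v ` {1..n}. \<bar>\<phi> a\<bar>"]) (simp, measurable)
  have "(\<integral>x. \<phi>' (snd x) \<partial>\<pi>) = (\<integral>y. \<phi>' y \<partial>empirical n v)"
    unfolding couplingsD(4)[OF \<pi>, symmetric] by (rule integral_distr[symmetric]) measurable
  also have "\<dots> = (\<integral>i. \<phi>' (v i) \<partial>uniform_count_measure {1..n})"
    unfolding empirical_def
    by (rule integral_distr[OF measurable_uniform_count_measure]) measurable
  also have "\<dots> = (\<Sum>i=1..n. \<phi> (v i)) / real n"
    by (subst integral_uniform_count_measure) (auto simp: \<phi>'_atom)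
  finally have eq\<phi>: "(\<integral>x. \<phi>' (snd x) \<partial>\<pi>) = (\<Sum>i=1..n. \<phi> (v i)) / real n" .
  have nn: "(\<integral>\<^sup>+ x. ennreal (norm (fst x - snd x) powr p) \<partial>\<pi>) \<le> ennreal D"
    using cost by (simp add: case_prod_unfold)
  have intc: "integrable \<pi> (\<lambda>x. norm (fst x - snd x) powr p)"
    by (rule integrableI_nonneg) (use nn in \<open>auto simp: less_top[symmetric] top_unique\<close>)
  have "ennreal (\<integral>x. norm (fst x - snd x) powr p \<partial>\<pi>) \<le> ennreal D"
    using nn by (subst nn_integral_eq_integral[OF intc, symmetric]) auto
  hence cD: "(\<integral>x. norm (fst x - snd x) powr p \<partial>\<pi>) \<le> D"
    using \<open>D \<ge> 0\<close> by (simp add: ennreal_le_iff)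
  let ?k = "\<lambda>y. indicator S y *\<^sub>R h y"
  have k: "integrable (distr \<pi> borel fst) ?k"
    using h unfolding couplingsD(3)[OF \<pi>] by (simp add: set_integrable_def)
  have km: "?k \<in> borel_measurable borel" using borel_measurable_integrable[OF k] by simp
  have fm: "fst \<in> borel_measurable \<pi>" by measurable
  have intk: "integrable \<pi> (\<lambda>x. ?k (fst x))"
    using k by (subst (asm) integrable_distr_eq[OF fm km])
  have "(LINT y:S|Q. h y) = (\<integral>y. ?k y \<partial>distr \<pi> borel fst)"
    unfolding couplingsD(3)[OF \<pi>] set_lebesgue_integral_def ..
  also have "\<dots> = (\<integral>x. ?k (fst x) \<partial>\<pi>)"
    by (rule integral_distr[OF fm km])
  also have "\<dots> \<le> (\<integral>x. \<phi>' (snd x) + C * norm (fst x - snd x) powr p \<partial>\<pi>)"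
  proof (rule integral_mono_AE[OF intk])
    show "integrable \<pi> (\<lambda>x. \<phi>' (snd x) + C * norm (fst x - snd x) powr p)"
      using int\<phi> intc by auto
    have "AE x in \<pi>. fst x \<in> S"
      using S unfolding couplingsD(3)[OF \<pi>, symmetric] by (rule AE_distrD[OF fm])
    moreover have "AE x in \<pi>. snd x \<in> v ` {1..n}"
      using AE_empirical[OF assms(1), of v] unfolding couplingsD(4)[OF \<pi>, symmetric]
      by (rule AE_distrD[rotated]) simp
    ultimately show "AE x in \<pi>. ?k (fst x) \<le> \<phi>' (snd x) + C * norm (fst x - snd x) powr p"
    proof eventually_elim
      case (elim x)
      then obtain i where "i \<in> {1..n}" "snd x = v i" by auto
      thus ?case using le[of "fst x" i] elim(1) by (simp add: \<phi>'_atom)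
    qed
  qed
  also have "\<dots> = (\<Sum>i=1..n. \<phi> (v i)) / real n + C * (\<integral>x. norm (fst x - snd x) powr p \<partial>\<pi>)"
    using int\<phi> intc eq\<phi> by simp
  also have "\<dots> \<le> (\<Sum>i=1..n. \<phi> (v i)) / real n + C * D"
    using cD \<open>C \<ge> 0\<close> by (intro add_left_mono mult_left_mono)
  finally show ?thesis .
qed

text \<open>For \<open>z\<close> in the ball of radius \<open>r\<close>, a nearby \<open>y\<close>
  is handled by uniform continuity and a distant one by the growth bound, whose constant part is
  absorbed into the transport cost. For \<open>z\<close> outside the ball the growth bound leaves a
  term in \<open>z\<close> alone, which can later be integrated as a tail.\<close>

lemma growth_modulus:
  fixes h :: "'a::euclidean_space \<Rightarrow> real"
  assumes "closed S" "continuous_on S h" "p \<ge> 1" "B \<ge> 0"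
    and growth: "\<And>y. y \<in> S \<Longrightarrow> \<bar>h y\<bar> \<le> B * (1 + norm y powr p)"
    and "e > 0" "r \<ge> 0"
  obtains C where "C \<ge> 0" "\<And>y z. y \<in> S \<Longrightarrow> z \<in> S \<Longrightarrow>
    h y - h z \<le> e + C * norm (y - z) powr p
      + (if norm z > r then B * (2 + 2 powr p) * (1 + norm z powr p) else 0)"
proof -
  let ?K = "B * (2 + 2 powr p)"
  let ?A = "S \<inter> cball 0 (r + 1)"
  have far: "h y - h z \<le> B * 2 powr p * norm (y - z) powr p + ?K * (1 + norm z powr p)"
    if "y \<in> S" "z \<in> S" for y z
  proof -
    have "norm y powr p \<le> (norm (y - z) + norm z) powr p"
      using norm_triangle_ineq[of "y - z" z] assms(3) by (intro powr_mono2) auto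
    also have "\<dots> \<le> 2 powr p * (norm (y - z) powr p + norm z powr p)"
      using assms(3) by (intro powr_add_le) auto
    finally have "B * norm y powr p \<le> B * (2 powr p * (norm (y - z) powr p + norm z powr p))"
      using assms(4) by (intro mult_left_mono)
    moreover have "B * (norm z powr p + 2) \<le> B * (2 * norm z powr p + 2 + 2 powr p)"
      using assms(4) by (intro mult_left_mono) auto
    ultimately show ?thesis using growth[OF that(1)] growth[OF that(2)]
      by (simp add: algebra_simps)
  qed
  have "uniformly_continuous_on ?A h"
    using assms(1,2) by (intro compact_uniformly_continuous continuous_on_subset[OF assms(2)] closed_Int_compact) auto
  then obtain d where d: "d > 0" "\<And>y z. y \<in> ?A \<Longrightarrow> z \<in> ?A \<Longrightarrow> dist y z < d \<Longrightarrow> dist (h y) (h z) < e"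
    using \<open>e > 0\<close> unfolding uniformly_continuous_on_def by metis
  \<comment> \<open>The cap at 1 keeps every \<open>y\<close> within \<open>d'\<close> of
    \<open>z\<close> inside the ball of radius \<open>r + 1\<close> on which \<open>h\<close> is
    uniformly continuous.\<close>
  define d' where "d' = min d 1"
  have d': "d' > 0" "d' \<le> 1" "d' \<le> d" using d by (auto simp: d'_def)
  \<comment> \<open>The second summand turns the bound \<open>?K * (1 + r powr p)\<close> into a
    multiple of \<open>norm (y - z) powr p\<close> as soon as
    \<open>norm (y - z) \<ge> d'\<close>.\<close>
  define C where "C = B * 2 powr p + ?K * (1 + r powr p) / d' powr p"
  have C: "C \<ge> B * 2 powr p" using assms d' by (simp add: C_def)
  show thesis
  proof (rule that[of C])
    show "C \<ge> 0" using C assms(4) by (meson mult_nonneg_nonneg order_trans powr_ge_zero)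
    fix y z assume yz: "y \<in> S" "z \<in> S"
    have C': "B * 2 powr p * norm (y - z) powr p \<le> C * norm (y - z) powr p"
      using C by (intro mult_right_mono) auto
    consider "norm z > r" | "norm z \<le> r" "norm (y - z) < d'" | "norm z \<le> r" "norm (y - z) \<ge> d'"
      by linarith
    thus "h y - h z \<le> e + C * norm (y - z) powr p + (if norm z > r then ?K * (1 + norm z powr p) else 0)"
    proof cases
      case 1
      thus ?thesis using far[OF yz] C' \<open>e > 0\<close> by simp
    next
      case 2
      have "norm y \<le> r + 1" using norm_triangle_ineq[of "y - z" z] 2 d' by simp
      hence "dist (h y) (h z) < e" using 2 yz d' by (intro d(2)) (auto simp: dist_norm)
      moreover have "0 \<le> C * norm (y - z) powr p" using \<open>C \<ge> 0\<close> by simp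
      ultimately show ?thesis using 2 by (simp add: dist_real_def)
    next
      case 3
      have "?K * (1 + norm z powr p) \<le> ?K * (1 + r powr p)"
        using 3 assms by (intro mult_left_mono add_left_mono powr_mono2) auto
      also have "\<dots> = ?K * (1 + r powr p) / d' powr p * d' powr p" using d' by simp
      also have "\<dots> \<le> ?K * (1 + r powr p) / d' powr p * norm (y - z) powr p"
        using 3 assms d' by (intro mult_left_mono powr_mono2) auto
      finally have "h y - h z \<le> C * norm (y - z) powr p"
        using far[OF yz] by (simp add: C_def algebra_simps)
      thus ?thesis using 3 \<open>e > 0\<close> by simp
    qed
  qed
qed

lemma integral_tail_small:
  fixes w :: "'a::real_normed_vector \<Rightarrow> real"
  assumes w: "integrable P w" "\<And>y. w y \<ge> 0" and [measurable_cong]: "sets P = sets borel" and "e > 0"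
  obtains r where "r \<ge> 0" "integrable P (\<lambda>y. if norm y > r then w y else 0)"
    "(\<integral>y. (if norm y > r then w y else 0) \<partial>P) < e"
proof -
  have [measurable]: "w \<in> borel_measurable P" using w by auto
  have "(\<lambda>k. \<integral>y. (if norm y > real k then w y else 0) \<partial>P) \<longlonglongrightarrow> (\<integral>y. 0 \<partial>P)"
  proof (rule integral_dominated_convergence[where w = w])
    show "AE y in P. (\<lambda>k. if norm y > real k then w y else 0) \<longlonglongrightarrow> 0"
    proof (rule AE_I2)
      fix y :: 'a
      obtain N where "norm y < real N" using reals_Archimedean2 by blast
      hence "eventually (\<lambda>k. (if norm y > real k then w y else 0) = 0) sequentially"
        unfolding eventually_sequentially by (intro exI[of _ N]) auto
      thus "(\<lambda>k. if norm y > real k then w y else 0) \<longlonglongrightarrow> 0" by (rule tendsto_eventually)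
    qed
  qed (use w in auto)
  hence "eventually (\<lambda>k. (\<integral>y. (if norm y > real k then w y else 0) \<partial>P) < e) sequentially"
    using \<open>e > 0\<close> by (intro order_tendstoD(2)) auto
  then obtain k where "(\<integral>y. (if norm y > real k then w y else 0) \<partial>P) < e"
    by (auto simp: eventually_sequentially)
  moreover have "integrable P (\<lambda>y. if norm y > real k then w y else 0)"
    by (rule Bochner_Integration.integrable_bound[OF w(1)]) (use w(2) in auto)
  ultimately show thesis using that[of "real k"] by auto
qed

text \<open>The order of quantifiers is the point: \<open>\<zeta>\<^sub>0\<close> depends on
  \<open>h\<close>, \<open>P\<close> and \<Delta>, but not on \<open>n\<close>, the atoms or
  \<open>Q\<close>. Only \<open>P\<close> has to have a small tail, because the tail term of the
  modulus is evaluated at the point drawn from \<open>P\<close>.\<close>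

lemma expectation_stable_wasserstein:
  fixes h :: "'a::euclidean_space \<Rightarrow> real"
  assumes S: "closed S" "S \<noteq> {}" "continuous_on S h" and p: "p \<ge> 1" and "B \<ge> 0"
    and growth: "\<And>y. y \<in> S \<Longrightarrow> \<bar>h y\<bar> \<le> B * (1 + norm y powr p)"
    and P: "prob_space P" "sets P = sets borel" "AE y in P. y \<in> S"
    and moment: "integrable P (\<lambda>y. norm y powr p)" and hP: "set_integrable P S h" and "\<Delta> > 0"
  obtains \<zeta>\<^sub>0 where "\<zeta>\<^sub>0 > 0"
    "\<And>\<zeta> n v Q. 0 < \<zeta> \<Longrightarrow> \<zeta> \<le> \<zeta>\<^sub>0 \<Longrightarrow> n \<ge> 1 \<Longrightarrow> (\<And>i. i \<in> {1..n} \<Longrightarrow> v i \<in> S) \<Longrightarrow>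
      wasserstein p P (empirical n v) \<le> ennreal \<zeta> \<Longrightarrow> wasserstein p Q (empirical n v) \<le> ennreal \<zeta> \<Longrightarrow>
      (AE y in Q. y \<in> S) \<Longrightarrow> set_integrable Q S h \<Longrightarrow> (LINT y:S|Q. h y) \<le> (LINT y:S|P. h y) + \<Delta>"
proof -
  interpret P: prob_space P by fact
  let ?e = "\<Delta> / 4" and ?K = "B * (2 + 2 powr p)"
  obtain r where r: "r \<ge> 0" "integrable P (\<lambda>y. if norm y > r then ?K * (1 + norm y powr p) else 0)"
    "(\<integral>y. (if norm y > r then ?K * (1 + norm y powr p) else 0) \<partial>P) < ?e"
    by (rule integral_tail_small[of P "\<lambda>y. ?K * (1 + norm y powr p)" ?e])
       (use moment P \<open>B \<ge> 0\<close> \<open>\<Delta> > 0\<close> in auto)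
  define T where "T = (\<lambda>y::'a. if norm y > r then ?K * (1 + norm y powr p) else 0)"
  have T: "integrable P T" "(\<integral>y. T y \<partial>P) < ?e" "\<And>y. T y \<ge> 0"
    using r \<open>B \<ge> 0\<close> by (auto simp: T_def)
  obtain C where C: "C \<ge> 0" "\<And>y z. y \<in> S \<Longrightarrow> z \<in> S \<Longrightarrow> h y - h z \<le> ?e + C * norm (y - z) powr p + T z"
    using growth_modulus[OF S(1,3) p \<open>B \<ge> 0\<close> growth, of ?e r] r(1) \<open>\<Delta> > 0\<close>
    unfolding T_def by (metis zero_less_divide_iff zero_less_numeral)
  \<comment> \<open>The factor \<open>2 powr p\<close> pays for splitting the cost from
    \<open>y\<close> to \<open>z\<close> at an intermediate atom \<open>u\<close>.\<close>
  define C2 where "C2 = C * 2 powr p"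
  have "C2 \<ge> 0" using C by (simp add: C2_def)
  have triple: "h y - C2 * norm (y - u) powr p \<le> h z + ?e + T z + C2 * norm (z - u) powr p"
    if "y \<in> S" "z \<in> S" for y z u
  proof -
    have "norm (y - z) \<le> norm (y - u) + norm (z - u)"
      using norm_triangle_ineq[of "y - u" "u - z"] by (simp add: norm_minus_commute)
    hence "norm (y - z) powr p \<le> (norm (y - u) + norm (z - u)) powr p"
      using p by (intro powr_mono2) auto
    also have "\<dots> \<le> 2 powr p * (norm (y - u) powr p + norm (z - u) powr p)"
      using p by (intro powr_add_le) auto
    finally have "C * norm (y - z) powr p \<le> C * (2 powr p * (norm (y - u) powr p + norm (z - u) powr p))"
      using C(1) by (intro mult_left_mono)
    thus ?thesis using C(2)[OF that] by (simp add: C2_def algebra_simps)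
  qed
  \<comment> \<open>The cost transform \<open>\<phi>\<close> of \<open>h\<close> separates the two couplings, so that the coupling of \<open>Q\<close> with the
    empirical measure and that of \<open>P\<close> with it need not be glued.\<close>
  define \<phi> where "\<phi> u = (SUP y\<in>S. h y - C2 * norm (y - u) powr p)" for u
  obtain s where "s \<in> S" using S(2) by blast
  \<comment> \<open>The estimate \<open>triple\<close> at a fixed point \<open>s\<close> bounds the
    supremum, so the potential is finite everywhere.\<close>
  have bdd: "bdd_above ((\<lambda>y. h y - C2 * norm (y - u) powr p) ` S)" for u
    using triple[OF _ \<open>s \<in> S\<close>] by (intro bdd_aboveI2)
  have \<phi>1: "h y \<le> \<phi> u + C2 * norm (y - u) powr p" if "y \<in> S" for y u
    using cSUP_upper[OF that bdd, of u] by (simp add: \<phi>_def)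
  have \<phi>2: "\<phi> u \<le> h z + ?e + T z + C2 * norm (z - u) powr p" if "z \<in> S" for z u
    unfolding \<phi>_def by (rule cSUP_least[OF S(2)]) (use triple that in blast)
  \<comment> \<open>Chosen such that
    \<open>(2 * \<zeta>\<^sub>0) powr p = \<Delta> / (8 * (C2 + 1))\<close>; the two transport costs
    together then stay below \<open>\<Delta> / 4\<close>. Doubling the radius gives the strict
    inequality that produces couplings, and \<open>C2 + 1\<close> guards against
    \<open>C2 = 0\<close>.\<close>
  define \<zeta>\<^sub>0 where "\<zeta>\<^sub>0 = (\<Delta> / (8 * (C2 + 1))) powr (1 / p) / 2"
  show thesis
  proof (rule that[of \<zeta>\<^sub>0])
    show "\<zeta>\<^sub>0 > 0" using \<open>\<Delta> > 0\<close> \<open>C2 \<ge> 0\<close> by (simp add: \<zeta>\<^sub>0_def)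
    fix \<zeta> n v Q
    assume \<zeta>: "0 < \<zeta>" "\<zeta> \<le> \<zeta>\<^sub>0" and n: "n \<ge> 1" and v: "\<And>i. i \<in> {1..n} \<Longrightarrow> v i \<in> S"
      and WP: "wasserstein p P (empirical n v) \<le> ennreal \<zeta>"
      and WQ: "wasserstein p Q (empirical n v) \<le> ennreal \<zeta>"
      and Q: "AE y in Q. y \<in> S" "set_integrable Q S h"
    define D where "D = (2 * \<zeta>) powr p"
    have "D \<ge> 0" by (simp add: D_def)
    have "ennreal \<zeta> < ennreal (2 * \<zeta>)" using \<zeta> by (intro ennreal_lessI) auto
    hence lt: "wasserstein p P (empirical n v) < ennreal (2 * \<zeta>)"
        "wasserstein p Q (empirical n v) < ennreal (2 * \<zeta>)"
      using WP WQ by (auto intro: le_less_trans)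
    have "p > 0" using p by simp
    obtain \<pi>\<^sub>P where \<pi>P: "\<pi>\<^sub>P \<in> couplings P (empirical n v)"
        "(\<integral>\<^sup>+ (y\<^sub>1, y\<^sub>2). ennreal (norm (y\<^sub>1 - y\<^sub>2) powr p) \<partial>\<pi>\<^sub>P) \<le> ennreal D"
      using coupling_of_wasserstein_less[OF lt(1) \<open>p > 0\<close>] unfolding D_def by blast
    obtain \<pi>\<^sub>Q where \<pi>Q: "\<pi>\<^sub>Q \<in> couplings Q (empirical n v)"
        "(\<integral>\<^sup>+ (y\<^sub>1, y\<^sub>2). ennreal (norm (y\<^sub>1 - y\<^sub>2) powr p) \<partial>\<pi>\<^sub>Q) \<le> ennreal D"
      using coupling_of_wasserstein_less[OF lt(2) \<open>p > 0\<close>] unfolding D_def by blast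
    have D2: "2 * (C2 * D) \<le> ?e"
    proof -
      have "D \<le> (2 * \<zeta>\<^sub>0) powr p" unfolding D_def using \<zeta> p by (intro powr_mono2) auto
      also have "\<dots> = \<Delta> / (8 * (C2 + 1))"
        using p \<open>\<Delta> > 0\<close> \<open>C2 \<ge> 0\<close> by (simp add: \<zeta>\<^sub>0_def powr_powr)
      finally have "(C2 + 1) * D \<le> \<Delta> / 8" using \<open>C2 \<ge> 0\<close> by (simp add: field_simps)
      thus ?thesis using \<open>D \<ge> 0\<close> by (simp add: algebra_simps)
    qed
    define avg where "avg = (\<Sum>i=1..n. \<phi> (v i)) / real n"
    have eT: "set_integrable P S (\<lambda>y. ?e + T y)"
      unfolding set_integrable_def
      using T P S(1) by (intro integrable_mult_indicator) auto
    have "(LINT y:S|P. ?e + T y) \<le> (\<integral>y. ?e + T y \<partial>P)"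
      using eT T \<open>\<Delta> > 0\<close> unfolding set_lebesgue_integral_def set_integrable_def
      by (intro integral_mono) (auto simp: indicator_def)
    hence eT2: "(LINT y:S|P. ?e + T y) \<le> 2 * ?e" using T by (simp add: P.prob_space)
    have "(LINT y:S|Q. h y) \<le> avg + C2 * D"
      unfolding avg_def by (rule coupling_empirical_integral_le[OF n \<pi>Q \<open>D \<ge> 0\<close> Q \<open>C2 \<ge> 0\<close>]) (use \<phi>1 in blast)
    \<comment> \<open>The same duality estimate, now with potential \<open>- \<phi>\<close>, bounds
      the expectation under \<open>P\<close> from below. Adding the two estimates cancels the
      average of \<open>\<phi>\<close> over the atoms.\<close>
    moreover have "(LINT y:S|P. - (h y + (?e + T y))) \<le> (\<Sum>i=1..n. - \<phi> (v i)) / real n + C2 * D"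
    proof (rule coupling_empirical_integral_le[OF n \<pi>P \<open>D \<ge> 0\<close> P(3) _ \<open>C2 \<ge> 0\<close>])
      show "set_integrable P S (\<lambda>y. - (h y + (?e + T y)))"
        using set_integral_add(1)[OF hP eT] unfolding set_integrable_def scaleR_minus_right
        by (rule Bochner_Integration.integrable_minus)
      show "- (h y + (?e + T y)) \<le> - \<phi> (v i) + C2 * norm (y - v i) powr p" if "y \<in> S" for y i
        using \<phi>2[OF that, of "v i"] by simp
    qed
    moreover have "(LINT y:S|P. - (h y + (?e + T y))) = - ((LINT y:S|P. h y) + (LINT y:S|P. ?e + T y))"
      by (subst set_integral_uminus[OF set_integral_add(1)[OF hP eT]])
         (subst set_integral_add(2)[OF hP eT], rule refl)
    moreover have "(\<Sum>i=1..n. - \<phi> (v i)) / real n = - avg" by (simp add: sum_negf avg_def)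
    ultimately have "(LINT y:S|Q. h y) \<le> avg + C2 * D"
        and "- ((LINT y:S|P. h y) + (LINT y:S|P. ?e + T y)) \<le> - avg + C2 * D"
      by simp_all
    thus "(LINT y:S|Q. h y) \<le> (LINT y:S|P. h y) + \<Delta>"
      using eT2 D2 \<open>\<Delta> > 0\<close> by linarith
  qed
qed

section \<open>The radius and the ball around the residual measure\<close>

text \<open>The bound \<open>t \<le> 1\<close> selects the first branch of both the radius and the
  rate, where the exponents \<open>min (p / d) (1 / 2)\<close> and \<open>max (d / p) 2\<close> are
  reciprocal. The condition \<open>\<alpha> < 2 * C\<close> makes the logarithm, and so the radius,
  positive.\<close>

lemma concentration_radius_props:
  fixes C c\<^sub>0 p a d \<alpha> t :: real and n :: nat
  assumes "c\<^sub>0 > 0" "p > 0" "d > 0" "n \<ge> 1" "0 < \<alpha>" "\<alpha> < 2 * C"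
    and t: "ln (2 * C / \<alpha>) / (c\<^sub>0 * real n) \<le> t" "t \<le> 1"
  defines "k \<equiv> concentration_radius C c\<^sub>0 p a d n \<alpha>"
  shows "0 < k" "k \<le> t powr min (p / d) (1 / 2)" "concentration_rate C c\<^sub>0 p a d n k = \<alpha> / 2"
proof -
  define l where "l = ln (2 * C / \<alpha>)"
  define b where "b = l / (c\<^sub>0 * real n)"
  have C: "C > 0" using assms by linarith
  have l: "l > 0" using assms by (simp add: l_def)
  have b: "0 < b" "b \<le> t" using l assms t by (auto simp: b_def l_def)
  have "l / c\<^sub>0 = b * real n" using assms by (simp add: b_def)
  also have "\<dots> \<le> 1 * real n" using b t by (intro mult_right_mono) auto
  finally have n: "l / c\<^sub>0 \<le> real n" by simp
  define s where "s = min (p / d) (1 / 2)"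
  have s: "s > 0" using assms by (simp add: s_def)
  have ms: "s * max (d / p) 2 = 1"
    using assms by (auto simp: s_def min_def max_def field_simps)
  have k: "k = b powr s"
    using n by (simp add: k_def concentration_radius_def l_def b_def s_def)
  show "0 < k" using b by (simp add: k)
  show "k \<le> t powr min (p / d) (1 / 2)"
    unfolding k s_def[symmetric] using b s by (intro powr_mono2) auto
  have "k \<le> 1" unfolding k using b t s by (intro powr_le1) auto
  moreover have "k powr max (d / p) 2 = b" using b by (simp add: k powr_powr ms)
  moreover have "c\<^sub>0 * real n * b = l" using assms by (simp add: b_def)
  moreover have "C * exp (- l) = \<alpha> / 2" using assms C by (simp add: l_def exp_minus)
  ultimately show "concentration_rate C c\<^sub>0 p a d n k = \<alpha> / 2"
    by (simp add: concentration_rate_def)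
qed

text \<open>Projection onto \<open>S\<close> is nonexpansive and fixes the exact atoms, so each atom
  moves by at most the error at \<open>x\<close> plus the error at \<open>xv i\<close>. The
  convexity factor \<open>2 powr (p - 1)\<close> times \<open>2 * k powr p\<close> is exactly
  \<open>(2 * k) powr p\<close>: the origin of the factor 2 in front of the threshold in the
  radius.\<close>

lemma wasserstein_er_empirical_le:
  assumes S: "closed S" "convex S" "S \<noteq> {}" and n: "n \<ge> 1" and p: "p \<ge> 1" and k: "k > 0" "k' > 0"
    and atoms: "\<And>i. i \<in> {1..n} \<Longrightarrow> f x + (yv i - f (xv i)) \<in> S"
    and err: "norm (f x - fh x) powr p \<le> k powr p"
      "(\<Sum>i=1..n. norm (f (xv i) - fh (xv i)) powr p) / real n \<le> k powr p"
    and W: "wasserstein p (empirical n (\<lambda>i. f x + (yv i - f (xv i)))) Q < ennreal k'"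
  shows "wasserstein p Q (er_empirical S n fh xv yv x) \<le> ennreal (2 * k + k')"
proof -
  let ?u = "\<lambda>i. f x + (yv i - f (xv i))" and ?w = "\<lambda>i. fh x + (yv i - fh (xv i))"
  let ?a = "norm (f x - fh x)" and ?b = "\<lambda>i. norm (f (xv i) - fh (xv i))"
  have le: "norm (?u i - closest_point S (?w i)) powr p \<le> 2 powr (p - 1) * (?a powr p + ?b i powr p)"
    if i: "i \<in> {1..n}" for i
  proof -
    have "norm (?u i - closest_point S (?w i)) = dist (closest_point S (?u i)) (closest_point S (?w i))"
      using closest_point_self[OF atoms[OF i]] by (simp add: dist_norm)
    also have "\<dots> \<le> dist (?u i) (?w i)" by (rule closest_point_lipschitz) (use S in auto)
    also have "\<dots> = norm ((f x - fh x) - (f (xv i) - fh (xv i)))"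
      by (simp add: dist_norm algebra_simps)
    also have "\<dots> \<le> ?a + ?b i" by (rule norm_triangle_ineq4)
    finally have "norm (?u i - closest_point S (?w i)) powr p \<le> (?a + ?b i) powr p"
      using p by (intro powr_mono2) auto
    also have "\<dots> \<le> 2 powr (p - 1) * (?a powr p + ?b i powr p)"
      using powr_add_le_weighted[of p ?a "?b i" 1 1] p by simp
    finally show ?thesis .
  qed
  have "(\<Sum>i=1..n. norm (?u i - closest_point S (?w i)) powr p) / real n
      \<le> (\<Sum>i=1..n. 2 powr (p - 1) * (?a powr p + ?b i powr p)) / real n"
    using le by (intro divide_right_mono sum_mono) auto
  also have "\<dots> = 2 powr (p - 1) * (?a powr p + (\<Sum>i=1..n. ?b i powr p) / real n)"
    using n by (simp add: sum.distrib add_divide_distrib distrib_left flip: sum_distrib_left)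
  also have "\<dots> \<le> 2 powr (p - 1) * (k powr p + k powr p)"
    using err by (intro mult_left_mono add_mono) auto
  also have "\<dots> = (2 * k) powr p" using k by (simp add: powr_diff powr_mult)
  finally have uv: "(\<Sum>i=1..n. norm (?u i - closest_point S (?w i)) powr p) / real n \<le> (2 * k) powr p" .
  obtain \<pi> where \<pi>: "\<pi> \<in> couplings (empirical n ?u) Q"
    "(\<integral>\<^sup>+ (y\<^sub>1, y\<^sub>2). ennreal (norm (y\<^sub>1 - y\<^sub>2) powr p) \<partial>\<pi>) \<le> ennreal (k' powr p)"
    using coupling_of_wasserstein_less[OF W] p by auto
  show ?thesis
    using wasserstein_empirical_triangle[OF n p k(2) _ \<pi> uv] k
    by (simp add: er_empirical_def add.commute)
qed

text \<open>Independence makes the joint law a product, and Fubini for null sets then freezes the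
  covariate. This is how almost every conditional law is seen to be carried by the support of the
  response.\<close>

lemma (in prob_space) AE_AE_shift_of_indep:
  fixes X :: "'a \<Rightarrow> 'b::second_countable_topology" and \<epsilon> :: "'a \<Rightarrow> 'c::euclidean_space"
  assumes [measurable]: "X \<in> borel_measurable M" "\<epsilon> \<in> borel_measurable M" "f \<in> borel_measurable borel"
    and S: "closed S" and AE: "AE \<omega> in M. f (X \<omega>) + \<epsilon> \<omega> \<in> S"
    and indep: "indep_set (sets (vimage_algebra (space M) \<epsilon> borel)) (sets (vimage_algebra (space M) X borel))"
  shows "AE x in distr M borel X. AE \<omega> in M. f x + \<epsilon> \<omega> \<in> S"
proof -
  have [measurable]: "S \<in> sets borel" using S by simp
  interpret E: prob_space "distr M borel \<epsilon>" by (rule prob_space_distr) simp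
  interpret D: prob_space "distr M borel X" by (rule prob_space_distr) simp
  interpret pair_sigma_finite "distr M borel \<epsilon>" "distr M borel X" ..
  have eq: "distr M borel \<epsilon> \<Otimes>\<^sub>M distr M borel X = distr M (borel \<Otimes>\<^sub>M borel) (\<lambda>\<omega>. (\<epsilon> \<omega>, X \<omega>))"
  proof (rule pair_measure_eqI)
    fix A B assume AB: "A \<in> sets (distr M borel \<epsilon>)" "B \<in> sets (distr M borel X)"
    hence [measurable]: "A \<in> sets borel" "B \<in> sets borel" by simp_all
    have "prob ((\<epsilon> -` A \<inter> space M) \<inter> (X -` B \<inter> space M))
        = prob (\<epsilon> -` A \<inter> space M) * prob (X -` B \<inter> space M)"
      by (rule indep_setD[OF indep]) (auto intro!: in_vimage_algebra)
    moreover have "(\<lambda>\<omega>. (\<epsilon> \<omega>, X \<omega>)) -` (A \<times> B) \<inter> space M = (\<epsilon> -` A \<inter> space M) \<inter> (X -` B \<inter> space M)"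
      by auto
    ultimately show "emeasure (distr M borel \<epsilon>) A * emeasure (distr M borel X) B
        = emeasure (distr M (borel \<Otimes>\<^sub>M borel) (\<lambda>\<omega>. (\<epsilon> \<omega>, X \<omega>))) (A \<times> B)"
      by (simp add: emeasure_distr emeasure_eq_measure ennreal_mult)
  qed (auto simp: E.sigma_finite_measure_axioms D.sigma_finite_measure_axioms)
  have "AE z in distr M (borel \<Otimes>\<^sub>M borel) (\<lambda>\<omega>. (\<epsilon> \<omega>, X \<omega>)). f (snd z) + fst z \<in> S"
    by (subst AE_distr_iff) (use AE in auto)
  hence "AE e in distr M borel \<epsilon>. AE x in distr M borel X. f x + e \<in> S"
    unfolding eq[symmetric] by (drule_tac AE_pair) simp
  hence "AE x in distr M borel X. AE e in distr M borel \<epsilon>. f x + e \<in> S"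
  proof (subst AE_commute[symmetric])
    show "{z \<in> space (distr M borel \<epsilon> \<Otimes>\<^sub>M distr M borel X). f (snd z) + fst z \<in> S}
        \<in> sets (distr M borel \<epsilon> \<Otimes>\<^sub>M distr M borel X)"
      by measurable
  qed
  thus ?thesis
    by (rule AE_mp) (rule AE_I2, subst (1) AE_distr_iff, auto)
qed

lemma threshold_near_inf:
  fixes P :: "real \<Rightarrow> bool"
  assumes "P k\<^sub>0" "\<And>k. P k \<Longrightarrow> 0 < k" "e > 0"
  obtains k where "P k" "\<And>k'. P k' \<Longrightarrow> k \<le> k' + e"
proof -
  have bdd: "bdd_below {k. P k}" using assms(2) by (intro bdd_belowI[of _ 0]) (auto intro: less_imp_le)
  obtain k where "P k" "k < Inf {k. P k} + e"
    using cInf_lessD[of "{k. P k}" "Inf {k. P k} + e"] assms by auto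
  thus thesis using that[of k] cInf_lower[OF _ bdd] by force
qed

section \<open>Choice of the constants and the final estimate\<close>

theorem theorem13:
  fixes M :: "'w measure"
    and X :: "'w \<Rightarrow> real ^ 'dx" and Y \<epsilon> :: "'w \<Rightarrow> real ^ 'dy"
    and xs :: "nat \<Rightarrow> 'w \<Rightarrow> real ^ 'dx" and ys :: "nat \<Rightarrow> 'w \<Rightarrow> real ^ 'dy"
    and \<X> :: "(real ^ 'dx) set" and \<Y> :: "(real ^ 'dy) set" and Z :: "(real ^ 'dz) set"
    and f :: "real ^ 'dx \<Rightarrow> real ^ 'dy"
    and R :: "nat \<Rightarrow> (nat \<Rightarrow> (real ^ 'dy) \<times> (real ^ 'dx)) \<Rightarrow> real ^ 'dx \<Rightarrow> real ^ 'dy"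
    and c :: "real ^ 'dz \<Rightarrow> real ^ 'dy \<Rightarrow> real"
    and law :: "real ^ 'dx \<Rightarrow> (real ^ 'dy) measure"
    and fhat :: "nat \<Rightarrow> 'w \<Rightarrow> real ^ 'dx \<Rightarrow> real ^ 'dy"
    and Pstar Phat :: "nat \<Rightarrow> 'w \<Rightarrow> real ^ 'dx \<Rightarrow> (real ^ 'dy) measure"
    and p a C c\<^sub>0 B d\<^sub>y :: real
    and K \<beta> :: "real \<Rightarrow> real ^ 'dx \<Rightarrow> real" and Kbar \<beta>bar :: "real \<Rightarrow> real"
    and L\<^sub>1 L\<^sub>2 :: "real ^ 'dz \<Rightarrow> real"
  assumes M: "prob_space M"
    and X: "X \<in> borel_measurable M" and Y: "Y \<in> borel_measurable M" "integrable M Y"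
    and \<X>: "\<X> = msupport (distr M borel X)"
    and \<Y>: "\<Y> = msupport (distr M borel Y)" "\<Y> \<noteq> {}" "convex \<Y>"
    and f: "f \<in> borel_measurable borel"
      "\<And>j. AE \<omega> in M.
         real_cond_exp M (vimage_algebra (space M) X borel) (\<lambda>\<omega>. Y \<omega> $ j) \<omega> = f (X \<omega>) $ j"
    and \<epsilon>: "\<epsilon> \<in> borel_measurable M" "\<And>\<omega>. \<omega> \<in> space M \<Longrightarrow> Y \<omega> = f (X \<omega>) + \<epsilon> \<omega>"
      "integrable M \<epsilon>" "integral\<^sup>L M \<epsilon> = 0"
      "prob_space.indep_set M (sets (vimage_algebra (space M) \<epsilon> borel))
         (sets (vimage_algebra (space M) X borel))"
    and law: "law = (\<lambda>x. distr M borel (\<lambda>\<omega>. f x + \<epsilon> \<omega>))"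
    and Z: "Z \<noteq> {}" "compact Z"
    and c_meas: "(\<lambda>(z, y). c z y) \<in> borel_measurable (restrict_space borel (Z \<times> \<Y>))"
    and g_integrable: "AE x in distr M borel X. \<forall>z\<in>Z. set_integrable (law x) \<Y> (c z)"
    and g_lsc: "AE x in distr M borel X. lsc_on Z (expected_cost \<Y> c (law x))"
    and data: "\<And>i. xs i \<in> borel_measurable M" "\<And>i. ys i \<in> borel_measurable M"
      "\<And>i. i \<ge> 1 \<Longrightarrow>
         distr M borel (\<lambda>\<omega>. (ys i \<omega>, xs i \<omega>)) = distr M borel (\<lambda>\<omega>. (Y \<omega>, X \<omega>))"
    and R: "\<And>n. (\<lambda>(D, x). R n D x) \<in> borel_measurable (PiM {1..n} (\<lambda>_. borel) \<Otimes>\<^sub>M borel)"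
    and fhat: "fhat = (\<lambda>n. estimate R n xs ys)"
    and Pstar: "Pstar = (\<lambda>n \<omega> x. empirical n (\<lambda>i. f x + (ys i \<omega> - f (xs i \<omega>))))"
    and Phat: "Phat = (\<lambda>n \<omega> x. er_empirical \<Y> n (fhat n \<omega>) (\<lambda>i. xs i \<omega>) (\<lambda>i. ys i \<omega>) x)"
    and dro: "\<And>n \<omega> x \<zeta>. n \<ge> 1 \<Longrightarrow> \<omega> \<in> space M \<Longrightarrow> x \<in> \<X> \<Longrightarrow> \<zeta> \<ge> 0 \<Longrightarrow>
        (\<forall>z\<in>Z. worst_case_real \<Y> p c (Phat n \<omega> x) \<zeta> z) \<and>
        lsc_on Z (worst_case_cost \<Y> p c (Phat n \<omega> x) \<zeta>)"
    and d\<^sub>y: "d\<^sub>y = real CARD('dy)"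
    and conc: "C \<ge> 1" "c\<^sub>0 > 0"
      "\<And>n x. n \<ge> 1 \<Longrightarrow> x \<in> \<X> \<Longrightarrow>
         (\<lambda>\<omega>. wasserstein p (Pstar n \<omega> x) (law x)) \<in> borel_measurable M"
      "\<And>k n x. k > 0 \<Longrightarrow> n \<ge> 1 \<Longrightarrow> x \<in> \<X> \<Longrightarrow>
         \<P>(\<omega> in M. wasserstein p (Pstar n \<omega> x) (law x) \<ge> ennreal k)
           \<le> concentration_rate C c\<^sub>0 p a d\<^sub>y n k"
    and p: "p \<ge> 1" "p \<noteq> d\<^sub>y / 2"
    and i: "a > p" "integrable M (\<lambda>\<omega>. exp (norm (\<epsilon> \<omega>) powr a))"
    and ii: "AE x in distr M borel X. \<forall>\<alpha>\<in>{0<..<1}. \<forall>n\<ge>1.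
        \<exists>k. error_threshold M f (fhat n) xs p n \<alpha> x k"
    and iii: "\<And>k. k > 0 \<Longrightarrow> AE x in distr M borel X. K k x > 0 \<and> \<beta> k x > 0 \<and> (\<forall>n\<ge>1.
          \<P>(\<omega> in M. norm (f x - fhat n \<omega> x) powr p > k powr p) \<le> K k x * exp (- real n * \<beta> k x))"
      "\<And>k. k > 0 \<Longrightarrow> Kbar k > 0 \<and> \<beta>bar k > 0 \<and> (\<forall>n\<ge>1.
          \<P>(\<omega> in M. (\<Sum>i=1..n. norm (f (xs i \<omega>) - fhat n \<omega> (xs i \<omega>)) powr p) / real n > k powr p)
            \<le> Kbar k * exp (- real n * \<beta>bar k))"
    and iv: "\<And>y. y \<in> \<Y> \<Longrightarrow> lsc_on Z (\<lambda>z. c z y)"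
      "\<And>z. z \<in> Z \<Longrightarrow> continuous_on \<Y> (c z)"
      "B \<ge> 0" "\<And>z y. z \<in> Z \<Longrightarrow> y \<in> \<Y> \<Longrightarrow> \<bar>c z y\<bar> \<le> B * (1 + norm y powr p)"
    and v: "prob_space.indep_vars M (\<lambda>_. borel) (\<lambda>i \<omega>. ys i \<omega> - f (xs i \<omega>)) {1..}"
      "\<And>i. i \<ge> 1 \<Longrightarrow> distr M borel (\<lambda>\<omega>. ys i \<omega> - f (xs i \<omega>)) = distr M borel \<epsilon>"
    and vi: "(\<forall>z\<in>Z. (L\<^sub>1 z)-lipschitz_on \<Y> (c z)) \<or>
      (p \<ge> 2 \<and> (\<exists>G. \<forall>z\<in>Z.
         (\<forall>y\<in>\<Y>. (c z has_derivative (\<lambda>h. G z y \<bullet> h)) (at y within \<Y>)) \<and>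
         set_integrable (distr M borel Y) \<Y> (\<lambda>y. (norm (G z y))\<^sup>2) \<and>
         (L\<^sub>2 z)-lipschitz_on \<Y> (G z)))"
  shows "\<exists>\<kappa>.
    (AE x in distr M borel X. \<forall>\<alpha>\<in>{0<..<1}. \<forall>n\<ge>1.
       error_threshold M f (fhat n) xs p n \<alpha> x (\<kappa> n \<alpha> x)) \<and>
    (AE x in distr M borel X. \<forall>\<eta>>0. \<exists>\<Gamma>>0. \<exists>\<gamma>>0. \<forall>n\<ge>1. \<forall>zhat\<in>borel_measurable M.
       (let \<alpha> = \<Gamma> * exp (- real n * \<gamma>); \<zeta> = dro_radius \<kappa> C c\<^sub>0 p a d\<^sub>y n \<alpha> x in
        (\<forall>\<omega>\<in>space M. zhat \<omega> \<in> minimizers Z (worst_case_cost \<Y> p c (Phat n \<omega> x) \<zeta>)) \<longrightarrow>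
        \<P>(\<omega> in M. infdist (zhat \<omega>) (minimizers Z (expected_cost \<Y> c (law x))) \<ge> \<eta>)
          \<le> 2 * \<Gamma> * exp (- real n * \<gamma>)))"
proof -
  interpret prob_space M by fact
  note [measurable] = X \<epsilon>(1) data(1,2) f(1)
  have S_closed: "closed \<Y>" unfolding \<Y>(1) by (rule closed_msupport)
  have p0: "p > 0" using p(1) by simp
  have \<epsilon>s [measurable]: "(\<lambda>\<omega>. ys i \<omega> - f (xs i \<omega>)) \<in> borel_measurable M" for i
    by measurable
  \<comment> \<open>The argument of the estimate is random because the estimate is evaluated both at
    a fixed \<open>x\<close> and at the covariate samples, which also enter its
    construction.\<close>
  have fhat_meas [measurable]: "(\<lambda>\<omega>. fhat n \<omega> (u \<omega>)) \<in> borel_measurable M"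
    if [measurable]: "u \<in> borel_measurable M" for n u
  proof -
    have "(\<lambda>\<omega>. (\<lambda>i\<in>{1..n}. (ys i \<omega>, xs i \<omega>), u \<omega>)) \<in> measurable M (PiM {1..n} (\<lambda>_. borel) \<Otimes>\<^sub>M borel)"
      by (intro measurable_Pair measurable_restrict borel_measurable_Pair data that)
    from measurable_compose[OF this R] show ?thesis by (simp add: fhat estimate_def)
  qed

  \<comment> \<open>The infimum of the thresholds need not be a positive threshold, hence the slack \<open>1 / n\<close>; it is
    harmless since the claim is trivial for \<open>\<alpha> \<ge> 1 / 2\<close>, and \<open>\<alpha> < 1 / 2\<close> forces \<open>n > 1 / \<gamma>\<close>.\<close>
  define \<kappa> where "\<kappa> n \<alpha> x = (SOME k. error_threshold M f (fhat n) xs p n \<alpha> x k \<and>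
    (\<forall>k'. error_threshold M f (fhat n) xs p n \<alpha> x k' \<longrightarrow> k \<le> k' + 1 / real n))" for n \<alpha> x
  have \<kappa>: "error_threshold M f (fhat n) xs p n \<alpha> x (\<kappa> n \<alpha> x) \<and>
      (\<forall>k'. error_threshold M f (fhat n) xs p n \<alpha> x k' \<longrightarrow> \<kappa> n \<alpha> x \<le> k' + 1 / real n)"
    if "error_threshold M f (fhat n) xs p n \<alpha> x k\<^sub>0" "n \<ge> 1" for n \<alpha> x k\<^sub>0
    unfolding \<kappa>_def
  proof (rule someI_ex)
    show "\<exists>k. error_threshold M f (fhat n) xs p n \<alpha> x k \<and>
      (\<forall>k'. error_threshold M f (fhat n) xs p n \<alpha> x k' \<longrightarrow> k \<le> k' + 1 / real n)"
      by (rule threshold_near_inf[of "error_threshold M f (fhat n) xs p n \<alpha> x" k\<^sub>0 "1 / real n"])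
         (use that in \<open>auto simp: error_threshold_def\<close>)
  qed

  have AE_X: "AE x in distr M borel X. x \<in> \<X>" unfolding \<X> by (rule AE_msupport) simp
  have "AE \<omega> in M. Y \<omega> \<in> \<Y>"
    using AE_msupport[of "distr M borel Y"] Y(1) unfolding \<Y>(1)[symmetric] by (auto dest: AE_distrD)
  hence "AE \<omega> in M. f (X \<omega>) + \<epsilon> \<omega> \<in> \<Y>"
    by (rule AE_mp) (rule AE_I2, use \<epsilon>(2) in simp)
  hence AE_law: "AE x in distr M borel X. AE \<omega> in M. f x + \<epsilon> \<omega> \<in> \<Y>"
    by (intro AE_AE_shift_of_indep[OF X \<epsilon>(1) f(1) S_closed _ \<epsilon>(5)])
  \<comment> \<open>The exceptional null set in (iii) depends on the tolerance. Restricting to the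
    countably many values \<open>1 / (m + 1)\<close> gives one null set for all of them;
    \<open>\<delta>\<close> below is picked among these.\<close>
  have AE_iii: "AE x in distr M borel X. \<forall>m::nat. K (1 / real (Suc m)) x > 0 \<and> \<beta> (1 / real (Suc m)) x > 0 \<and>
      (\<forall>n\<ge>1. \<P>(\<omega> in M. norm (f x - fhat n \<omega> x) powr p > (1 / real (Suc m)) powr p)
         \<le> K (1 / real (Suc m)) x * exp (- real n * \<beta> (1 / real (Suc m)) x))"
    unfolding AE_all_countable by (intro allI iii(1)) simp

  show ?thesis
  proof (intro exI[of _ \<kappa>] conjI)
    show "AE x in distr M borel X. \<forall>\<alpha>\<in>{0<..<1}. \<forall>n\<ge>1. error_threshold M f (fhat n) xs p n \<alpha> x (\<kappa> n \<alpha> x)"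
      using ii by eventually_elim (use \<kappa> in blast)
  next
    show "AE x in distr M borel X. \<forall>\<eta>>0. \<exists>\<Gamma>>0. \<exists>\<gamma>>0. \<forall>n\<ge>1. \<forall>zhat\<in>borel_measurable M.
       (let \<alpha> = \<Gamma> * exp (- real n * \<gamma>); \<zeta> = dro_radius \<kappa> C c\<^sub>0 p a d\<^sub>y n \<alpha> x in
        (\<forall>\<omega>\<in>space M. zhat \<omega> \<in> minimizers Z (worst_case_cost \<Y> p c (Phat n \<omega> x) \<zeta>)) \<longrightarrow>
        \<P>(\<omega> in M. infdist (zhat \<omega>) (minimizers Z (expected_cost \<Y> c (law x))) \<ge> \<eta>)
          \<le> 2 * \<Gamma> * exp (- real n * \<gamma>))"
      \<comment> \<open>All null sets are discarded here, before \<open>\<eta>\<close> is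
        introduced, so one exceptional set serves every \<open>\<eta>\<close>.\<close>
      using AE_X AE_law AE_iii g_integrable g_lsc ii
    proof eventually_elim
      case (elim x)
      have x: "x \<in> \<X>" and law_Y: "AE \<omega> in M. f x + \<epsilon> \<omega> \<in> \<Y>"
        and g_int: "\<And>z. z \<in> Z \<Longrightarrow> set_integrable (law x) \<Y> (c z)"
        and lsc: "lsc_on Z (expected_cost \<Y> c (law x))"
        and thr: "\<And>\<alpha> n. 0 < \<alpha> \<Longrightarrow> \<alpha> < 1 \<Longrightarrow> n \<ge> 1 \<Longrightarrow> \<exists>k. error_threshold M f (fhat n) xs p n \<alpha> x k"
        using elim by auto
      have law_x: "law x = distr M borel (\<lambda>\<omega>. f x + \<epsilon> \<omega>)" by (simp add: law)
      have law_prob: "prob_space (law x)" unfolding law_x by (rule prob_space_distr) simp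
      have law_sets: "sets (law x) = sets borel" by (simp add: law_x)
      have law_AE: "AE y in law x. y \<in> \<Y>"
        unfolding law_x using law_Y S_closed by (subst AE_distr_iff) auto
      \<comment> \<open>The \<open>p\<close>-th power is at most 1 or at most the
        \<open>a\<close>-th power, according to whether the norm of the error exceeds 1; in both
        cases the exponential dominates it.\<close>
      have moment: "integrable (law x) (\<lambda>y. norm y powr p)"
      proof -
        have "integrable M (\<lambda>\<omega>. norm (f x + \<epsilon> \<omega>) powr p)"
        proof (rule Bochner_Integration.integrable_bound)
          show "integrable M (\<lambda>\<omega>. 2 powr p * (norm (f x) powr p + exp (norm (\<epsilon> \<omega>) powr a)))"
            using i(2) by simp
          show "AE \<omega> in M. norm (norm (f x + \<epsilon> \<omega>) powr p)
              \<le> norm (2 powr p * (norm (f x) powr p + exp (norm (\<epsilon> \<omega>) powr a)))"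
          proof (rule AE_I2)
            fix \<omega>
            have "norm (\<epsilon> \<omega>) powr p \<le> 1 + norm (\<epsilon> \<omega>) powr a"
            proof (cases "norm (\<epsilon> \<omega>) \<le> 1")
              case True
              hence "norm (\<epsilon> \<omega>) powr p \<le> 1" using p0 by (intro powr_le1) auto
              thus ?thesis by (meson add_increasing2 powr_ge_zero)
            next
              case False
              hence "norm (\<epsilon> \<omega>) powr p \<le> norm (\<epsilon> \<omega>) powr a" using i(1) by (intro powr_mono) auto
              thus ?thesis by simp
            qed
            also have "\<dots> \<le> exp (norm (\<epsilon> \<omega>) powr a)" by (rule exp_ge_add_one_self)
            finally have e: "norm (\<epsilon> \<omega>) powr p \<le> exp (norm (\<epsilon> \<omega>) powr a)" .
            have "norm (f x + \<epsilon> \<omega>) powr p \<le> (norm (f x) + norm (\<epsilon> \<omega>)) powr p"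
              using p0 by (intro powr_mono2 norm_triangle_ineq) auto
            also have "\<dots> \<le> 2 powr p * (norm (f x) powr p + norm (\<epsilon> \<omega>) powr p)"
              using p(1) by (intro powr_add_le) auto
            also have "\<dots> \<le> 2 powr p * (norm (f x) powr p + exp (norm (\<epsilon> \<omega>) powr a))"
              using e by (intro mult_left_mono add_left_mono) auto
            finally show "norm (norm (f x + \<epsilon> \<omega>) powr p)
              \<le> norm (2 powr p * (norm (f x) powr p + exp (norm (\<epsilon> \<omega>) powr a)))" by simp
          qed
        qed measurable
        thus ?thesis unfolding law_x by (subst integrable_distr_eq) auto
      qed
      show ?case
      proof (intro allI impI)
        fix \<eta> :: real assume \<eta>: "\<eta> > 0"
        let ?g = "expected_cost \<Y> c (law x)"
        obtain z where z: "z \<in> Z" "\<And>u. u \<in> Z \<Longrightarrow> ?g z \<le> ?g u"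
          using lsc_on_attains_min[OF Z(2,1) lsc] by blast
        hence "z \<in> minimizers Z ?g" by (force simp: minimizers_def is_arg_min_def)
        then obtain \<Delta> where \<Delta>: "\<Delta> > 0"
          "\<And>u. u \<in> Z \<Longrightarrow> infdist u (minimizers Z ?g) \<ge> \<eta> \<Longrightarrow> ?g z + \<Delta> < ?g u"
          using minimizers_gap[OF Z(2) lsc \<eta>] by metis
        obtain \<zeta>\<^sub>0 where \<zeta>\<^sub>0: "\<zeta>\<^sub>0 > 0"
          "\<And>\<zeta> n v Q. 0 < \<zeta> \<Longrightarrow> \<zeta> \<le> \<zeta>\<^sub>0 \<Longrightarrow> n \<ge> 1 \<Longrightarrow> (\<And>i. i \<in> {1..n} \<Longrightarrow> v i \<in> \<Y>) \<Longrightarrow>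
            wasserstein p (law x) (empirical n v) \<le> ennreal \<zeta> \<Longrightarrow> wasserstein p Q (empirical n v) \<le> ennreal \<zeta> \<Longrightarrow>
            (AE y in Q. y \<in> \<Y>) \<Longrightarrow> set_integrable Q \<Y> (c z) \<Longrightarrow>
            (LINT y:\<Y>|Q. c z y) \<le> (LINT y:\<Y>|law x. c z y) + \<Delta>"
          using expectation_stable_wasserstein[OF S_closed \<Y>(2) iv(2)[OF z(1)] p(1) iv(3) iv(4)[OF z(1)]
              law_prob law_sets law_AE moment g_int[OF z(1)] \<Delta>(1)] by metis
        obtain m where "1 / real (Suc m) < \<zeta>\<^sub>0 / 8" using \<zeta>\<^sub>0(1) nat_approx_posE[of "\<zeta>\<^sub>0 / 8"] by auto
        define \<delta> where "\<delta> = 1 / real (Suc m)"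
        have \<delta>: "0 < \<delta>" "\<delta> < \<zeta>\<^sub>0 / 8" using \<open>1 / real (Suc m) < \<zeta>\<^sub>0 / 8\<close> by (auto simp: \<delta>_def)
        have K: "K \<delta> x > 0" "\<beta> \<delta> x > 0" "\<And>n. n \<ge> 1 \<Longrightarrow>
          \<P>(\<omega> in M. norm (f x - fhat n \<omega> x) powr p > \<delta> powr p) \<le> K \<delta> x * exp (- real n * \<beta> \<delta> x)"
          using elim(3) unfolding \<delta>_def by blast+
        note Kb = iii(2)[OF \<delta>(1)]
        define s where "s = min (p / d\<^sub>y) (1 / 2)"
        have s: "s > 0" using p0 d\<^sub>y by (simp add: s_def)
        \<comment> \<open>\<open>t\<close> bounds the base of the concentration radius: at most 1 to
          stay in the first branch, and with \<open>t powr s \<le> \<zeta>\<^sub>0 / 4\<close> to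
          make that part of the radius small.\<close>
        define t where "t = min 1 ((\<zeta>\<^sub>0 / 4) powr (1 / s))"
        have t: "0 < t" "t \<le> 1" using \<zeta>\<^sub>0(1) by (auto simp: t_def)
        have "t powr s \<le> ((\<zeta>\<^sub>0 / 4) powr (1 / s)) powr s" using t s by (intro powr_mono2) (auto simp: t_def)
        also have "\<dots> = \<zeta>\<^sub>0 / 4" using s \<zeta>\<^sub>0(1) by (simp add: powr_powr)
        finally have ts: "t powr s \<le> \<zeta>\<^sub>0 / 4" .
        \<comment> \<open>The factors 4 turn each of the two bounds of (iii) into \<alpha>/4. The
          entry \<open>2 * C\<close> yields \<open>ln (2 * C / \<alpha>) \<le> n * \<gamma>\<close>
          and, as \<open>C \<ge> 1\<close>, also \<open>\<Gamma> \<ge> 2\<close>. In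
          \<open>\<gamma>\<close>, the entry \<open>\<zeta>\<^sub>0 / 8\<close> controls the slack
          \<open>1 / n\<close> and \<open>c\<^sub>0 * t\<close> the concentration radius.\<close>
        define \<Gamma> where "\<Gamma> = max (max (4 * K \<delta> x) (4 * Kbar \<delta>)) (2 * C)"
        define \<gamma> where "\<gamma> = min (min (\<beta> \<delta> x) (\<beta>bar \<delta>)) (min (\<zeta>\<^sub>0 / 8) (c\<^sub>0 * t))"
        have \<Gamma>: "\<Gamma> > 0" "4 * K \<delta> x \<le> \<Gamma>" "4 * Kbar \<delta> \<le> \<Gamma>" "2 * C \<le> \<Gamma>" "2 \<le> \<Gamma>"
          using conc(1) by (auto simp: \<Gamma>_def)
        have \<gamma>: "\<gamma> > 0" "\<gamma> \<le> \<beta> \<delta> x" "\<gamma> \<le> \<beta>bar \<delta>" "\<gamma> \<le> \<zeta>\<^sub>0 / 8" "\<gamma> \<le> c\<^sub>0 * t"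
          using K(2) Kb \<zeta>\<^sub>0(1) conc(2) t by (auto simp: \<gamma>_def)
        show "\<exists>\<Gamma>>0. \<exists>\<gamma>>0. \<forall>n\<ge>1. \<forall>zhat\<in>borel_measurable M.
          (let \<alpha> = \<Gamma> * exp (- real n * \<gamma>); \<zeta> = dro_radius \<kappa> C c\<^sub>0 p a d\<^sub>y n \<alpha> x in
          (\<forall>\<omega>\<in>space M. zhat \<omega> \<in> minimizers Z (worst_case_cost \<Y> p c (Phat n \<omega> x) \<zeta>)) \<longrightarrow>
          \<P>(\<omega> in M. infdist (zhat \<omega>) (minimizers Z (expected_cost \<Y> c (law x))) \<ge> \<eta>)
            \<le> 2 * \<Gamma> * exp (- real n * \<gamma>))"
          unfolding Let_def
        proof (rule exI[of _ \<Gamma>], rule conjI[OF \<Gamma>(1)], rule exI[of _ \<gamma>], rule conjI[OF \<gamma>(1)],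
            intro allI impI ballI)
          fix n :: nat and zhat :: "'w \<Rightarrow> real ^ 'dz"
          assume n: "n \<ge> 1" and zhat_meas [measurable]: "zhat \<in> borel_measurable M"
          define \<alpha> where "\<alpha> = \<Gamma> * exp (- real n * \<gamma>)"
          define \<zeta> where "\<zeta> = dro_radius \<kappa> C c\<^sub>0 p a d\<^sub>y n \<alpha> x"
          assume "\<forall>\<omega>\<in>space M. zhat \<omega> \<in> minimizers Z (worst_case_cost \<Y> p c (Phat n \<omega> x)
            (dro_radius \<kappa> C c\<^sub>0 p a d\<^sub>y n (\<Gamma> * exp (- real n * \<gamma>)) x))"
          hence zhat: "\<And>\<omega>. \<omega> \<in> space M \<Longrightarrow> zhat \<omega> \<in> minimizers Z (worst_case_cost \<Y> p c (Phat n \<omega> x) \<zeta>)"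
            by (simp add: \<zeta>_def \<alpha>_def)
          have "\<P>(\<omega> in M. infdist (zhat \<omega>) (minimizers Z ?g) \<ge> \<eta>) \<le> 2 * \<alpha>"
          proof (cases "\<alpha> < 1 / 2")
            case False
            thus ?thesis by (intro order_trans[OF prob_le_1]) simp
          next
            case \<alpha>_small: True
            have \<alpha>0: "\<alpha> > 0" using \<Gamma>(1) by (simp add: \<alpha>_def)
            have "2 * exp (- real n * \<gamma>) \<le> \<alpha>" unfolding \<alpha>_def using \<Gamma>(5) by (intro mult_right_mono) auto
            hence small: "exp (- real n * \<gamma>) < 1 / 4" using \<alpha>_small by simp
            \<comment> \<open>Since \<open>\<Gamma> \<ge> 2\<close>, the smallness of \<alpha>
              pushes the exponential below 1/4, whereas \<open>exp (- 1)\<close> is at least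
              1/3.\<close>
            have "real n * \<gamma> > 1"
            proof (rule ccontr)
              assume "\<not> real n * \<gamma> > 1"
              hence "exp (- 1 :: real) \<le> exp (- real n * \<gamma>)" by simp
              moreover have "exp (- 1 :: real) \<ge> 1 / 3"
                using exp_le by (simp add: exp_minus field_simps)
              ultimately show False using small by linarith
            qed
            hence "1 / real n \<le> \<gamma>" using n by (simp add: field_simps)
            hence n_large: "1 / real n \<le> \<zeta>\<^sub>0 / 8" using \<gamma>(4) by linarith
            have exp_le_\<alpha>: "A * exp (- real n * b) \<le> \<alpha> / 4" if "4 * A \<le> \<Gamma>" "\<gamma> \<le> b" "A > 0" for A b
            proof -
              have "4 * A * exp (- real n * b) \<le> \<Gamma> * exp (- real n * \<gamma>)"
                using that \<Gamma>(1) by (intro mult_mono) (auto intro: mult_left_mono)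
              thus ?thesis by (simp add: \<alpha>_def)
            qed
            define k where "k = \<kappa> n (\<alpha> / 4) x"
            \<comment> \<open>By the choice of \<open>\<Gamma>\<close> and \<open>\<gamma>\<close>
              the tolerance \<open>\<delta>\<close> is itself an admissible threshold, so
              near-minimality gives \<open>k \<le> \<delta> + 1 / n\<close>, at most
              \<open>\<zeta>\<^sub>0 / 4\<close>.\<close>
            have "error_threshold M f (fhat n) xs p n (\<alpha> / 4) x \<delta>"
              unfolding error_threshold_def
              using \<delta>(1) K(3)[OF n] Kb n exp_le_\<alpha>[OF \<Gamma>(2) \<gamma>(2) K(1)] exp_le_\<alpha>[OF \<Gamma>(3) \<gamma>(3)]
              by (auto intro: order_trans)
            from \<kappa>[OF this n] this have k_thr: "error_threshold M f (fhat n) xs p n (\<alpha> / 4) x k" and "k \<le> \<delta> + 1 / real n"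
              unfolding k_def by blast+
            hence k: "0 < k" "k \<le> \<zeta>\<^sub>0 / 4" using \<delta> n_large by (auto simp: error_threshold_def)
            define k2 where "k2 = concentration_radius C c\<^sub>0 p a d\<^sub>y n \<alpha>"
            have k2: "0 < k2" "k2 \<le> t powr s" "concentration_rate C c\<^sub>0 p a d\<^sub>y n k2 = \<alpha> / 2"
            proof -
              have "2 * C / \<alpha> = 2 * C / \<Gamma> * exp (real n * \<gamma>)"
                by (simp add: \<alpha>_def exp_minus field_simps)
              also have "\<dots> \<le> 1 * exp (real n * \<gamma>)"
                using \<Gamma> by (intro mult_right_mono) auto
              finally have "2 * C / \<alpha> \<le> exp (real n * \<gamma>)" by simp
              moreover have "2 * C / \<alpha> > 0" using conc(1) \<alpha>0 by simp
              ultimately have "ln (2 * C / \<alpha>) \<le> ln (exp (real n * \<gamma>))"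
                by (subst ln_le_cancel_iff) auto
              hence "ln (2 * C / \<alpha>) \<le> real n * \<gamma>" by simp
              also have "\<dots> \<le> real n * (c\<^sub>0 * t)" using \<gamma>(5) by (intro mult_left_mono) auto
              finally have "ln (2 * C / \<alpha>) / (c\<^sub>0 * real n) \<le> t"
                using conc(2) n by (simp add: field_simps)
              moreover have "d\<^sub>y > 0" by (simp add: d\<^sub>y)
              ultimately show "0 < k2" "k2 \<le> t powr s" "concentration_rate C c\<^sub>0 p a d\<^sub>y n k2 = \<alpha> / 2"
                unfolding k2_def s_def
                using concentration_radius_props[of c\<^sub>0 p d\<^sub>y n \<alpha> C t a] conc(1,2) p0 n \<alpha>0 \<alpha>_small t(2)
                by auto
            qed
            have \<zeta>_eq: "\<zeta> = 2 * k + k2" by (simp add: \<zeta>_def dro_radius_def k_def k2_def)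
            have \<zeta>: "0 < \<zeta>" "\<zeta> \<le> \<zeta>\<^sub>0" using k k2 ts unfolding \<zeta>_eq by linarith+
            define E1 where "E1 = {\<omega>\<in>space M. norm (f x - fhat n \<omega> x) powr p > k powr p}"
            define E2 where "E2 = {\<omega>\<in>space M.
              (\<Sum>i=1..n. norm (f (xs i \<omega>) - fhat n \<omega> (xs i \<omega>)) powr p) / real n > k powr p}"
            define E3 where "E3 = {\<omega>\<in>space M. wasserstein p (Pstar n \<omega> x) (law x) \<ge> ennreal k2}"
            have [measurable]: "(\<lambda>\<omega>. wasserstein p (Pstar n \<omega> x) (law x)) \<in> borel_measurable M"
              by (rule conc(3)[OF n x])
            have E [measurable]: "E1 \<in> sets M" "E2 \<in> sets M" "E3 \<in> sets M"
              unfolding E1_def E2_def E3_def by measurable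
            \<comment> \<open>Each sample error has the law of \<open>\<epsilon>\<close>, so its
              shift by \<open>f x\<close> lies in the support almost surely. The projection
              therefore leaves the exact atoms unchanged.\<close>
            have atoms: "AE \<omega> in M. \<forall>i\<in>{1..n}. f x + (ys i \<omega> - f (xs i \<omega>)) \<in> \<Y>"
            proof (subst AE_finite_all, simp, intro ballI)
              fix i assume "i \<in> {1..n}"
              hence eq: "distr M borel (\<lambda>\<omega>. ys i \<omega> - f (xs i \<omega>)) = distr M borel \<epsilon>" by (intro v(2)) simp
              have [measurable]: "\<Y> \<in> sets borel" using S_closed by simp
              have "AE e in distr M borel \<epsilon>. f x + e \<in> \<Y>"
                using law_Y by (subst AE_distr_iff) auto
              thus "AE \<omega> in M. f x + (ys i \<omega> - f (xs i \<omega>)) \<in> \<Y>"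
                unfolding eq[symmetric] by (rule AE_distrD[OF \<epsilon>s])
            qed
            have "\<P>(\<omega> in M. infdist (zhat \<omega>) (minimizers Z ?g) \<ge> \<eta>) \<le> prob (E1 \<union> E2 \<union> E3)"
            proof (rule finite_measure_mono_AE)
              show "AE \<omega> in M. \<omega> \<in> {\<omega>\<in>space M. infdist (zhat \<omega>) (minimizers Z ?g) \<ge> \<eta>} \<longrightarrow> \<omega> \<in> E1 \<union> E2 \<union> E3"
                using atoms
              proof eventually_elim
                case (elim \<omega>)
                show ?case
                proof (intro impI, rule ccontr)
                  assume \<omega>: "\<omega> \<in> {\<omega>\<in>space M. infdist (zhat \<omega>) (minimizers Z ?g) \<ge> \<eta>}"
                    and nE: "\<omega> \<notin> E1 \<union> E2 \<union> E3"
                  hence sp: "\<omega> \<in> space M" and far: "infdist (zhat \<omega>) (minimizers Z ?g) \<ge> \<eta>" by auto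
                  have W: "wasserstein p (law x) (Phat n \<omega> x) \<le> ennreal \<zeta>"
                    unfolding Phat \<zeta>_eq
                    by (rule wasserstein_er_empirical_le[where f = f])
                       (use S_closed \<Y> n p(1) k(1) k2(1) elim nE sp in
                         \<open>auto simp: E1_def E2_def E3_def Pstar not_less not_le\<close>)
                  have wc: "\<And>u. u \<in> Z \<Longrightarrow> worst_case_real \<Y> p c (Phat n \<omega> x) \<zeta> u"
                    using dro[OF n sp x] \<zeta>(1) by auto
                  let ?ball = "wasserstein_ball \<Y> p (Phat n \<omega> x) \<zeta>"
                  have law_ball: "law x \<in> ?ball"
                    using W law_prob law_sets law_AE by (simp add: wasserstein_ball_def prob_measures_on_def)
                  define w where "w = (\<lambda>i. closest_point \<Y> (fhat n \<omega> x + (ys i \<omega> - fhat n \<omega> (xs i \<omega>))))"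
                  have Phat_w: "Phat n \<omega> x = empirical n w" by (simp add: Phat er_empirical_def w_def)
                  have w: "w i \<in> \<Y>" for i unfolding w_def using S_closed \<Y>(2) by (rule closest_point_in_set)
                  have zh: "zhat \<omega> \<in> Z" "\<And>u. u \<in> Z \<Longrightarrow>
                      worst_case_cost \<Y> p c (Phat n \<omega> x) \<zeta> (zhat \<omega>) \<le> worst_case_cost \<Y> p c (Phat n \<omega> x) \<zeta> u"
                    using zhat[OF sp] by (auto simp: minimizers_def is_arg_min_def not_less)
                  have "?g (zhat \<omega>) \<le> worst_case_cost \<Y> p c (Phat n \<omega> x) \<zeta> (zhat \<omega>)"
                    unfolding worst_case_cost_def using wc[OF zh(1)] law_ball
                    by (intro cSUP_upper) (auto simp: worst_case_real_def)
                  also have "\<dots> \<le> worst_case_cost \<Y> p c (Phat n \<omega> x) \<zeta> z" by (rule zh(2)[OF z(1)])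
                  also have "\<dots> \<le> ?g z + \<Delta>"
                    unfolding worst_case_cost_def
                  proof (rule cSUP_least)
                    show "?ball \<noteq> {}" using law_ball by blast
                    fix Q assume Q: "Q \<in> ?ball"
                    have "set_integrable Q \<Y> (c z)" using wc[OF z(1)] Q by (auto simp: worst_case_real_def)
                    moreover have "AE y in Q. y \<in> \<Y>" "wasserstein p Q (empirical n w) \<le> ennreal \<zeta>"
                      using Q by (auto simp: wasserstein_ball_def prob_measures_on_def Phat_w)
                    ultimately show "expected_cost \<Y> c Q z \<le> ?g z + \<Delta>"
                      unfolding expected_cost_def using W w unfolding Phat_w by (intro \<zeta>\<^sub>0(2)[OF \<zeta> n])
                  qed
                  finally show False using \<Delta>(2)[OF zh(1) far] by simp
                qed
              qed
            qed measurable
            also have "\<dots> \<le> prob E1 + prob E2 + prob E3"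
              using measure_Un_le[of "E1 \<union> E2" M E3] measure_Un_le[of E1 M E2] E by simp
            \<comment> \<open>The levels come from the definition of the radius: each error event is
              controlled at \<alpha>/4, and \<open>k2\<close> is the point where the concentration
              rate equals \<alpha>/2.\<close>
            also have "\<dots> \<le> \<alpha> / 4 + \<alpha> / 4 + \<alpha> / 2"
              using k_thr conc(4)[OF k2(1) n x] unfolding k2(3) E1_def E2_def E3_def error_threshold_def
              by (intro add_mono) auto
            also have "\<dots> \<le> 2 * \<alpha>" using \<alpha>0 by simp
            finally show ?thesis .
          qed
          thus "\<P>(\<omega> in M. infdist (zhat \<omega>) (minimizers Z ?g) \<ge> \<eta>) \<le> 2 * \<Gamma> * exp (- real n * \<gamma>)"
            by (simp add: \<alpha>_def mult.assoc)
        qed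
      qed
    qed
  qed
qed

end
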